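(* There exist infinitely many real quadratic number fields $K$, and infinitely many imaginary quadratic number fields $K$, whose ring of integers $\mathcal{O}_K$ contains a nonzero ideal $I$ such that the planar lattice $\Lambda_K(I)$ is well-rounded.
   Context: For a number field $K$ of degree $d$ with real embeddings $\sigma_1,\dots,\sigma_{r_1}$ and $r_2$ pairs of complex conjugate embeddings, choose one embedding $\tau_m$ from each complex pair ($1\le m\le r_2$), so $d=r_1+2r_2$. Define $\sigma:K\to\mathbb{R}^d$ by $\sigma(x)=(\sigma_1(x),\dots,\sigma_{r_1}(x),\Re\tau_1(x),\Im\tau_1(x),\dots,\Re\tau_{r_2}(x),\Im\tau_{r_2}(x))$. For a nonzero fractional ideal $I$ of $\mathcal{O}_K$, $\Lambda_K(I):=\sigma(I)$ is a full-rank lattice in $\mathbb{R}^d$. For a full-rank lattice $\Lambda\subset\mathbb{R}^d$, its minimum is $|\Lambda|=\min\{\|x\|^2: x\in\Lambda\setminus\{0\}\}$ (Euclidean norm), its set of minimal vectors is $S(\Lambda)=\{x\in\Lambda:\|x\|^2=|\Lambda|\}$, and $\Lambda$ is well-rounded (WR) if $S(\Lambda)$ spans $\mathbb{R}^d$. *)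

theory Defs
  imports "HOL-Analysis.Analysis" "HOL-Algebra.Algebraic_Closure_Type"
begin

text \<open>
  Number fields are taken as subfields of \<open>\<complex>\<close>. Every number field is isomorphic to one of these, and
  two quadratic subfields of \<open>\<complex>\<close> are isomorphic only if they are equal
  (\<open>quadratic_field_iso_imp_eq\<close> below), so counting quadratic subfields of \<open>\<complex>\<close> is counting quadratic
  fields up to isomorphism.
\<close>

abbreviation complex_ring :: "complex ring"
  where "complex_ring \<equiv> ring_of_type_algebra"

definition number_field :: "complex set \<Rightarrow> bool"
  where "number_field K \<longleftrightarrow> subfield K complex_ring \<and> ring.finite_dimension complex_ring \<rat> K"

definition field_degree :: "complex set \<Rightarrow> nat"
  where "field_degree K = ring.dim complex_ring \<rat> K"

definition ring_of_integers :: "complex set \<Rightarrow> complex ring"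
  where "ring_of_integers K = complex_ring\<lparr>carrier := {x \<in> K. algebraic_int x}\<rparr>"

text \<open>Embeddings are made extensional, so that they are determined by their values on \<open>K\<close>.\<close>

definition embeddings :: "complex set \<Rightarrow> (complex \<Rightarrow> complex) set"
  where "embeddings K = ring_hom (complex_ring\<lparr>carrier := K\<rparr>) complex_ring \<inter> extensional K"

definition real_embeddings :: "complex set \<Rightarrow> (complex \<Rightarrow> complex) set"
  where "real_embeddings K = {\<sigma> \<in> embeddings K. \<sigma> ` K \<subseteq> \<real>}"

definition complex_embeddings :: "complex set \<Rightarrow> (complex \<Rightarrow> complex) set"
  where "complex_embeddings K = embeddings K - real_embeddings K"

definition conj_embedding :: "complex set \<Rightarrow> (complex \<Rightarrow> complex) \<Rightarrow> complex \<Rightarrow> complex"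
  where "conj_embedding K \<tau> = restrict (\<lambda>x. cnj (\<tau> x)) K"

text \<open>
  \<open>rs\<close> is an ordering of the real embeddings, \<open>cs\<close> an ordered choice of one embedding from each pair of
  complex conjugate ones; \<open>ex_embedding_system\<close> below shows that quadratic fields have such lists.
\<close>

definition embedding_system ::
    "complex set \<Rightarrow> (complex \<Rightarrow> complex) list \<Rightarrow> (complex \<Rightarrow> complex) list \<Rightarrow> bool"
  where "embedding_system K rs cs \<longleftrightarrow>
    distinct rs \<and> set rs = real_embeddings K \<and>
    distinct cs \<and> set cs \<subseteq> complex_embeddings K \<and>
    (\<forall>\<tau>\<in>complex_embeddings K. \<tau> \<in> set cs \<longleftrightarrow> conj_embedding K \<tau> \<notin> set cs)"

text \<open>The type \<open>'n\<close> is meant to have \<open>r\<^sub>1 + 2 r\<^sub>2\<close> elements.\<close>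

definition canonical_embedding ::
    "(complex \<Rightarrow> complex) list \<Rightarrow> (complex \<Rightarrow> complex) list \<Rightarrow> complex \<Rightarrow> real ^ 'n::{finite,numeral}"
  where "canonical_embedding rs cs x =
    vector (map (\<lambda>\<sigma>. Re (\<sigma> x)) rs @ concat (map (\<lambda>\<tau>. [Re (\<tau> x), Im (\<tau> x)]) cs))"

definition ideal_lattice ::
    "(complex \<Rightarrow> complex) list \<Rightarrow> (complex \<Rightarrow> complex) list \<Rightarrow> complex set \<Rightarrow> (real ^ 'n::{finite,numeral}) set"
  where "ideal_lattice rs cs I = canonical_embedding rs cs ` I"

definition full_rank_lattice :: "'a::euclidean_space set \<Rightarrow> bool"
  where "full_rank_lattice \<Lambda> \<longleftrightarrow>
    (\<exists>B. Real_Vector_Spaces.independent B \<and> Real_Vector_Spaces.span B = UNIV \<and>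
         \<Lambda> = {\<Sum>b\<in>B. of_int (c b) *\<^sub>R b | c :: 'a \<Rightarrow> int. True})"

definition lattice_minimum :: "'a::euclidean_space set \<Rightarrow> real"
  where "lattice_minimum \<Lambda> = (LEAST r. r \<in> (\<lambda>x. (norm x)\<^sup>2) ` (\<Lambda> - {0}))"

definition minimal_vectors :: "'a::euclidean_space set \<Rightarrow> 'a set"
  where "minimal_vectors \<Lambda> = {x \<in> \<Lambda>. (norm x)\<^sup>2 = lattice_minimum \<Lambda>}"

definition well_rounded :: "'a::euclidean_space set \<Rightarrow> bool"
  where "well_rounded \<Lambda> \<longleftrightarrow>
    full_rank_lattice \<Lambda> \<and> Real_Vector_Spaces.span (minimal_vectors \<Lambda>) = UNIV"

definition quadratic_field :: "complex set \<Rightarrow> bool"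
  where "quadratic_field K \<longleftrightarrow> number_field K \<and> field_degree K = 2"

definition real_quadratic_field :: "complex set \<Rightarrow> bool"
  where "real_quadratic_field K \<longleftrightarrow> quadratic_field K \<and> complex_embeddings K = {}"

definition imaginary_quadratic_field :: "complex set \<Rightarrow> bool"
  where "imaginary_quadratic_field K \<longleftrightarrow> quadratic_field K \<and> real_embeddings K = {}"

lemma rats_subfield: "subfield \<rat> complex_ring"
proof -
  interpret field complex_ring by (rule field_from_type_algebra)
  have "subring \<rat> complex_ring"
  proof (rule subringI)
    fix h :: complex assume "h \<in> \<rat>"
    have "\<ominus>\<^bsub>complex_ring\<^esub> h = - h"
      by (rule minus_equality) (simp_all add: ring_of_type_algebra_def)
    then show "\<ominus>\<^bsub>complex_ring\<^esub> h \<in> \<rat>" using \<open>h \<in> \<rat>\<close> by simp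
  qed (simp_all add: ring_of_type_algebra_def)
  then show ?thesis
  proof (rule subfieldI')
    fix k assume k: "k \<in> \<rat> - {\<zero>\<^bsub>complex_ring\<^esub>}"
    then have "k \<noteq> 0" by (simp add: ring_of_type_algebra_def)
    then have "inv\<^bsub>complex_ring\<^esub> k = inverse k"
      by (intro comm_inv_char) (simp_all add: ring_of_type_algebra_def)
    then show "inv\<^bsub>complex_ring\<^esub> k \<in> \<rat>" using k by simp
  qed
qed

lemma subfield_closed:
  assumes "subfield K complex_ring"
  shows "0 \<in> K" "1 \<in> K" "\<And>x y. x \<in> K \<Longrightarrow> y \<in> K \<Longrightarrow> x + y \<in> K"
    "\<And>x y. x \<in> K \<Longrightarrow> y \<in> K \<Longrightarrow> x * y \<in> K" "\<And>x. x \<in> K \<Longrightarrow> - x \<in> K"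
proof -
  interpret field complex_ring by (rule field_from_type_algebra)
  have K: "subring K complex_ring"
    using assms by (simp add: subfield_def subdomain_def subcring_def)
  show "0 \<in> K" "1 \<in> K" "\<And>x y. x \<in> K \<Longrightarrow> y \<in> K \<Longrightarrow> x + y \<in> K"
    "\<And>x y. x \<in> K \<Longrightarrow> y \<in> K \<Longrightarrow> x * y \<in> K"
    using subringE(2,3,6,7)[OF K] by (simp_all add: ring_of_type_algebra_def)
  fix x assume "x \<in> K"
  moreover have "\<ominus>\<^bsub>complex_ring\<^esub> x = - x"
    by (rule minus_equality) (simp_all add: ring_of_type_algebra_def)
  ultimately show "- x \<in> K" using subringE(5)[OF K] by fastforce
qed

lemma quadratic_field_basis:
  assumes "quadratic_field K"
  obtains u where "u \<in> K" "K = {a + b * u | a b. a \<in> \<rat> \<and> b \<in> \<rat>}"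
proof -
  interpret field complex_ring by (rule field_from_type_algebra)
  have K: "subfield K complex_ring" and dimK: "dimension 2 \<rat> K"
    using assms finite_dimensionE[OF rats_subfield, of K]
    by (auto simp: quadratic_field_def number_field_def field_degree_def over_def)
  note mem = line_extension_mem_iff
  obtain v E where v: "v \<notin> E" "dimension 1 \<rat> E" "K = line_extension \<rat> v E"
    using dimK by (cases rule: dimension.cases) (auto simp: numeral_2_eq_2)
  obtain w F where w': "w \<notin> F" "dimension 0 \<rat> F" "E = line_extension \<rat> w F"
    using v(2) by (cases rule: dimension.cases) auto
  have "F = {0}"
    using w'(2) by (cases rule: dimension.cases) (auto simp: ring_of_type_algebra_def)
  then have w: "w \<noteq> 0" "E = line_extension \<rat> w {0}" using w' by auto
  have E: "E = {l * w | l. l \<in> \<rat>}"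
    unfolding w(2) by (auto simp: mem) (auto simp: ring_of_type_algebra_def)
  have KE: "K = {k * v + l * w | k l. k \<in> \<rat> \<and> l \<in> \<rat>}"
    unfolding v(3) by (auto simp: mem E) (auto simp: ring_of_type_algebra_def)
  obtain k l where kl: "1 = k * v + l * w" "k \<in> \<rat>" "l \<in> \<rat>"
    using subfield_closed(2)[OF K] unfolding KE by blast
  show ?thesis
  proof (cases "l = 0")
    case True
    then have kv: "k * v = 1" using kl by simp
    then have k0: "k \<noteq> 0" by auto
    then have k: "k \<noteq> 0" "v = 1 / k" using kv by (simp_all add: eq_divide_eq mult.commute)
    show ?thesis
    proof (rule that[of w])
      have "w = 0 * v + 1 * w" by simp
      then show "w \<in> K" unfolding KE using Rats_0 Rats_1 by blast
      show "K = {a + b * w | a b. a \<in> \<rat> \<and> b \<in> \<rat>}"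
      proof (intro equalityI subsetI)
        fix x assume "x \<in> K"
        then obtain p q where "x = p * v + q * w" "p \<in> \<rat>" "q \<in> \<rat>" unfolding KE by blast
        moreover have "p * v \<in> \<rat>" using \<open>p \<in> \<rat>\<close> k kl by simp
        ultimately show "x \<in> {a + b * w | a b. a \<in> \<rat> \<and> b \<in> \<rat>}" by blast
      next
        fix x assume "x \<in> {a + b * w | a b. a \<in> \<rat> \<and> b \<in> \<rat>}"
        then obtain a b where "x = a + b * w" "a \<in> \<rat>" "b \<in> \<rat>" by blast
        moreover have "a = (a * k) * v" using k by simp
        moreover have "a * k \<in> \<rat>" using \<open>a \<in> \<rat>\<close> kl(2) by simp
        ultimately have "x = (a * k) * v + b * w \<and> a * k \<in> \<rat> \<and> b \<in> \<rat>" by simp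
        then show "x \<in> K" unfolding KE by blast
      qed
    qed
  next
    case False
    then have w': "w = 1 / l - (k / l) * v" using kl by (simp add: field_simps)
    show ?thesis
    proof (rule that[of v])
      have "v = 1 * v + 0 * w" by simp
      then show "v \<in> K" unfolding KE using Rats_0 Rats_1 by blast
      show "K = {a + b * v | a b. a \<in> \<rat> \<and> b \<in> \<rat>}"
      proof (intro equalityI subsetI)
        fix x assume "x \<in> K"
        then obtain p q where pq: "x = p * v + q * w" "p \<in> \<rat>" "q \<in> \<rat>" unfolding KE by blast
        have "x = q / l + (p - q * k / l) * v"
          unfolding pq(1) w' by (simp add: algebra_simps)
        moreover have "q / l \<in> \<rat>" "p - q * k / l \<in> \<rat>" using pq kl by simp_all
        ultimately show "x \<in> {a + b * v | a b. a \<in> \<rat> \<and> b \<in> \<rat>}" by blast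
      next
        fix x assume "x \<in> {a + b * v | a b. a \<in> \<rat> \<and> b \<in> \<rat>}"
        then obtain a b where ab: "x = a + b * v" "a \<in> \<rat>" "b \<in> \<rat>" by blast
        have "x = a * (k * v + l * w) + b * v" using kl ab by simp
        also have "\<dots> = (a * k + b) * v + (a * l) * w" by (simp add: algebra_simps)
        finally have "x = (a * k + b) * v + (a * l) * w" .
        moreover have "a * k + b \<in> \<rat>" "a * l \<in> \<rat>" using ab kl by simp_all
        ultimately show "x \<in> K" unfolding KE by blast
      qed
    qed
  qed
qed

lemma hom_simps:
  assumes "h \<in> ring_hom (complex_ring\<lparr>carrier := K\<rparr>) complex_ring"
  shows "h 1 = 1" "\<And>x y. x \<in> K \<Longrightarrow> y \<in> K \<Longrightarrow> h (x + y) = h x + h y"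
    "\<And>x y. x \<in> K \<Longrightarrow> y \<in> K \<Longrightarrow> h (x * y) = h x * h y"
  using assms by (auto simp: ring_hom_def ring_of_type_algebra_def)

lemma hom_fixes_rats:
  assumes "subfield K complex_ring"
    and "h \<in> ring_hom (complex_ring\<lparr>carrier := K\<rparr>) complex_ring" and "q \<in> \<rat>" "\<rat> \<subseteq> K"
  shows "h q = q"
proof -
  note h = hom_simps[OF assms(2)] and K = subfield_closed[OF assms(1)]
  have h0: "h 0 = 0" using h(2)[OF K(1) K(1)] by simp
  have nat: "h (of_nat n) = of_nat n" for n
  proof (induction n)
    case (Suc n)
    have "of_nat n \<in> K" using assms(4) by auto
    then show ?case using h(2)[OF K(2), of "of_nat n"] h(1) Suc by simp
  qed (simp add: h0)
  have int: "h (of_int i) = of_int i" for i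
  proof (cases "i \<ge> 0")
    case True
    then show ?thesis using nat[of "nat i"] by simp
  next
    case False
    have "h (of_int i + of_nat (nat (- i))) = h (of_int i) + h (of_nat (nat (- i)))"
      using assms(4) by (intro h(2)) auto
    then show ?thesis using nat[of "nat (- i)"] h0 False by (simp add: add_eq_0_iff2)
  qed
  obtain a b :: int where ab: "b \<noteq> 0" "q = of_int a / of_int b"
    using assms(3) by (metis Rats_cases' less_irrefl)
  have "h (q * of_int b) = h q * h (of_int b)"
    using assms(3,4) by (intro h(3)) auto
  then have "of_int a = h q * of_int b" using ab int by simp
  then have "h q = of_int a / of_int b" using ab(1) by (simp add: eq_divide_eq)
  then show ?thesis using ab(2) by simp
qed

lemma quadratic_hom_generator:
  assumes "quadratic_field K"
  obtains u c where "u \<in> K" "c \<in> \<rat>" "K = {a + b * u | a b. a \<in> \<rat> \<and> b \<in> \<rat>}"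
    "\<And>h. h \<in> ring_hom (complex_ring\<lparr>carrier := K\<rparr>) complex_ring \<Longrightarrow>
       (h u = u \<or> h u = c - u) \<and> (\<forall>a\<in>\<rat>. \<forall>b\<in>\<rat>. h (a + b * u) = a + b * h u)"
proof -
  obtain u where u: "u \<in> K" "K = {a + b * u | a b. a \<in> \<rat> \<and> b \<in> \<rat>}"
    by (rule quadratic_field_basis[OF assms])
  have K: "subfield K complex_ring"
    using assms by (simp add: quadratic_field_def number_field_def)
  have "q \<in> K" if "q \<in> \<rat>" for q
  proof -
    have "q = q + 0 * u \<and> q \<in> \<rat> \<and> 0 \<in> (\<rat> :: complex set)" using that by simp
    then show ?thesis by (subst u(2)) blast
  qed
  then have QK: "\<rat> \<subseteq> K" by blast
  obtain a c where ac: "u * u = a + c * u" "a \<in> \<rat>" "c \<in> \<rat>"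
    using subfield_closed(4)[OF K u(1) u(1)] u(2) by blast
  show ?thesis
  proof (rule that[OF u(1) ac(3) u(2)])
    fix h assume h: "h \<in> ring_hom (complex_ring\<lparr>carrier := K\<rparr>) complex_ring"
    have lin: "h (a + b * u) = a + b * h u" if "a \<in> \<rat>" "b \<in> \<rat>" for a b
    proof -
      have "a \<in> K" "b \<in> K" using that QK by auto
      then show ?thesis
        using hom_simps(2)[OF h, of a "b * u"] hom_simps(3)[OF h, of b u]
          hom_fixes_rats[OF K h that(1) QK] hom_fixes_rats[OF K h that(2) QK]
          u(1) subfield_closed(4)[OF K, of b u]
        by simp
    qed
    have "h u * h u = a + c * h u"
      using lin[OF ac(2,3)] hom_simps(3)[OF h u(1) u(1)] ac(1) by simp
    then have "(h u - u) * (h u - (c - u)) = 0"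
      using ac(1) by (simp add: algebra_simps)
    then show "(h u = u \<or> h u = c - u) \<and> (\<forall>a\<in>\<rat>. \<forall>b\<in>\<rat>. h (a + b * u) = a + b * h u)"
      using lin by auto
  qed
qed

lemma quadratic_field_iso_imp_eq:
  assumes "quadratic_field K" and "complex_ring\<lparr>carrier := K\<rparr> \<simeq> complex_ring\<lparr>carrier := L\<rparr>"
  shows "K = L"
proof -
  obtain h where h: "h \<in> ring_iso (complex_ring\<lparr>carrier := K\<rparr>) (complex_ring\<lparr>carrier := L\<rparr>)"
    using assms(2) by (auto simp: is_ring_iso_def)
  then have hom: "h \<in> ring_hom (complex_ring\<lparr>carrier := K\<rparr>) complex_ring" and L: "L = h ` K"
    by (auto simp: ring_iso_def ring_hom_def ring_of_type_algebra_def bij_betw_def)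
  obtain u c where u: "u \<in> K" "c \<in> \<rat>" "K = {a + b * u | a b. a \<in> \<rat> \<and> b \<in> \<rat>}"
    and *: "\<And>h. h \<in> ring_hom (complex_ring\<lparr>carrier := K\<rparr>) complex_ring \<Longrightarrow>
       (h u = u \<or> h u = c - u) \<and> (\<forall>a\<in>\<rat>. \<forall>b\<in>\<rat>. h (a + b * u) = a + b * h u)"
    by (rule quadratic_hom_generator[OF assms(1)]) blast
  have hu: "h u = u \<or> h u = c - u"
    and lin: "\<And>a b. a \<in> \<rat> \<Longrightarrow> b \<in> \<rat> \<Longrightarrow> h (a + b * u) = a + b * h u"
    using *[OF hom] by auto
  have img: "L = {a + b * h u | a b. a \<in> \<rat> \<and> b \<in> \<rat>}"
  proof (intro equalityI subsetI)
    fix x assume "x \<in> L"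
    then obtain y where y: "y \<in> K" "x = h y" unfolding L by blast
    then obtain a b where ab: "y = a + b * u" "a \<in> \<rat>" "b \<in> \<rat>" by (subst (asm) u(3)) blast
    then have "x = a + b * h u" using y lin by simp
    then show "x \<in> {a + b * h u | a b. a \<in> \<rat> \<and> b \<in> \<rat>}" using ab by blast
  next
    fix x assume "x \<in> {a + b * h u | a b. a \<in> \<rat> \<and> b \<in> \<rat>}"
    then obtain a b where ab': "x = a + b * h u" "a \<in> \<rat>" "b \<in> \<rat>" by blast
    then have ab: "x = h (a + b * u)" using lin by simp
    have "a + b * u \<in> K" by (subst u(3)) (use ab' in blast)
    then show "x \<in> L" unfolding L ab by blast
  qed
  from hu show ?thesis
  proof
    assume "h u = u"
    then show ?thesis by (subst u(3), subst img) (simp only:)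
  next
    assume hu: "h u = c - u"
    have swap: "{a + b * x | a b. a \<in> \<rat> \<and> b \<in> \<rat>} \<subseteq> {a + b * (c - x) | a b. a \<in> \<rat> \<and> b \<in> \<rat>}" for x
    proof
      fix y assume "y \<in> {a + b * x | a b. a \<in> \<rat> \<and> b \<in> \<rat>}"
      then obtain a b where ab: "y = a + b * x" "a \<in> \<rat>" "b \<in> \<rat>" by blast
      have "y = (a + b * c) + (- b) * (c - x)" using ab by (simp add: algebra_simps)
      moreover have "a + b * c \<in> \<rat>" "- b \<in> \<rat>" using ab u(2) by simp_all
      ultimately show "y \<in> {a + b * (c - x) | a b. a \<in> \<rat> \<and> b \<in> \<rat>}" by blast
    qed
    have "{a + b * (c - u) | a b. a \<in> \<rat> \<and> b \<in> \<rat>} \<subseteq> {a + b * u | a b. a \<in> \<rat> \<and> b \<in> \<rat>}"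
      using swap[of "c - u"] by simp
    then have "{a + b * u | a b. a \<in> \<rat> \<and> b \<in> \<rat>} = {a + b * (c - u) | a b. a \<in> \<rat> \<and> b \<in> \<rat>}"
      using swap[of u] by (rule subset_antisym[rotated])
    then show ?thesis by (subst u(3), subst img) (simp only: hu)
  qed
qed

lemma finite_embeddings:
  assumes "quadratic_field K"
  shows "finite (embeddings K)"
proof -
  obtain u c where K: "K = {a + b * u | a b. a \<in> \<rat> \<and> b \<in> \<rat>}"
    and *: "\<And>h. h \<in> ring_hom (complex_ring\<lparr>carrier := K\<rparr>) complex_ring \<Longrightarrow>
       (h u = u \<or> h u = c - u) \<and> (\<forall>a\<in>\<rat>. \<forall>b\<in>\<rat>. h (a + b * u) = a + b * h u)"
    by (rule quadratic_hom_generator[OF assms]) blast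
  have "inj_on (\<lambda>h. h u) (embeddings K)"
  proof (rule inj_onI)
    fix f g assume fg: "f \<in> embeddings K" "g \<in> embeddings K" "f u = g u"
    show "f = g"
    proof (rule extensionalityI)
      show "f \<in> extensional K" "g \<in> extensional K" using fg by (simp_all add: embeddings_def)
      fix x assume "x \<in> K"
      then obtain a b where x: "x = a + b * u" and ab: "a \<in> \<rat>" "b \<in> \<rat>"
        by (subst (asm) K) blast
      show "f x = g x"
        unfolding x using *[of f] *[of g] fg ab by (simp add: embeddings_def)
    qed
  qed
  moreover have "(\<lambda>h. h u) ` embeddings K \<subseteq> {u, c - u}"
    using * by (auto simp: embeddings_def)
  ultimately show ?thesis by (meson finite.emptyI finite.insertI inj_on_finite)
qed

lemma conj_conj_embedding:
  assumes "\<tau> \<in> embeddings K"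
  shows "conj_embedding K (conj_embedding K \<tau>) = \<tau>"
  using assms by (auto simp: conj_embedding_def embeddings_def extensional_def fun_eq_iff)

lemma conj_complex_embedding:
  assumes "subfield K complex_ring" and "\<tau> \<in> complex_embeddings K"
  shows "conj_embedding K \<tau> \<in> complex_embeddings K" "conj_embedding K \<tau> \<noteq> \<tau>"
proof -
  have \<tau>: "\<tau> \<in> ring_hom (complex_ring\<lparr>carrier := K\<rparr>) complex_ring" and nr: "\<not> \<tau> ` K \<subseteq> \<real>"
    using assms(2) by (auto simp: complex_embeddings_def real_embeddings_def embeddings_def)
  have "conj_embedding K \<tau> \<in> embeddings K"
    using \<tau> subfield_closed[OF assms(1)]
    by (auto simp: embeddings_def conj_embedding_def ring_hom_def ring_of_type_algebra_def)
  moreover obtain x where x: "x \<in> K" "\<tau> x \<notin> \<real>" using nr by blast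
  ultimately show "conj_embedding K \<tau> \<in> complex_embeddings K"
    by (auto simp: complex_embeddings_def real_embeddings_def conj_embedding_def Reals_cnj_iff)
  show "conj_embedding K \<tau> \<noteq> \<tau>"
    using x by (auto simp: conj_embedding_def fun_eq_iff Reals_cnj_iff)
qed

lemma ex_embedding_system:
  assumes "quadratic_field K"
  shows "\<exists>rs cs. embedding_system K rs cs"
proof -
  have K: "subfield K complex_ring"
    using assms by (simp add: quadratic_field_def number_field_def)
  let ?C = "complex_embeddings K" and ?c = "conj_embedding K"
  have fin: "finite (real_embeddings K)" "finite ?C"
    using finite_embeddings[OF assms] by (simp_all add: real_embeddings_def complex_embeddings_def)
  have cc: "?c (?c \<tau>) = \<tau>" if "\<tau> \<in> ?C" for \<tau>
    using that by (simp add: conj_conj_embedding complex_embeddings_def)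
  note cC = conj_complex_embedding[OF K]
  define f where "f \<tau> = (SOME x. x \<in> {\<tau>, ?c \<tau>})" for \<tau>
  have f_mem: "f \<tau> \<in> {\<tau>, ?c \<tau>}" for \<tau>
    unfolding f_def by (rule someI[of _ \<tau>]) simp
  have f_conj: "f (?c \<tau>) = f \<tau>" if "\<tau> \<in> ?C" for \<tau>
    using cc[OF that] by (simp add: f_def insert_commute)
  have f_idem: "f \<tau> = \<tau>" if \<tau>: "\<tau> \<in> f ` ?C" for \<tau>
  proof -
    obtain \<rho> where \<rho>: "\<rho> \<in> ?C" "\<tau> = f \<rho>" using \<tau> by blast
    then show ?thesis using f_mem[of \<rho>] f_conj[OF \<rho>(1)] by auto
  qed
  have iff: "\<tau> \<in> f ` ?C \<longleftrightarrow> ?c \<tau> \<notin> f ` ?C" if \<tau>: "\<tau> \<in> ?C" for \<tau>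
  proof
    assume "\<tau> \<in> f ` ?C"
    then show "?c \<tau> \<notin> f ` ?C" using f_idem f_conj[OF \<tau>] cC(2)[OF \<tau>] by metis
  next
    assume "?c \<tau> \<notin> f ` ?C"
    then show "\<tau> \<in> f ` ?C" using f_mem[of \<tau>] \<tau> by (metis empty_iff imageI insert_iff)
  qed
  have sub: "f ` ?C \<subseteq> ?C" 
  proof
    fix x assume "x \<in> f ` ?C"
    then obtain \<tau> where "\<tau> \<in> ?C" "x = f \<tau>" by blast
    then show "x \<in> ?C" using f_mem[of \<tau>] cC(1)[of \<tau>] by auto
  qed
  obtain rs where rs: "set rs = real_embeddings K" "distinct rs"
    using fin(1) finite_distinct_list by blast
  obtain cs where cs: "set cs = f ` ?C" "distinct cs"
    using fin(2) finite_distinct_list by (metis finite_imageI)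
  have "embedding_system K rs cs"
    using rs cs sub iff by (simp add: embedding_system_def)
  then show ?thesis by blast
qed

end

theory Submission
  imports Defs "HOL-Computational_Algebra.Squarefree"
begin

text \<open>
  Let \<open>D = p q\<close> be squarefree with \<open>p > 0\<close> and \<open>p\<close>, \<open>q\<close> odd, and \<open>K = \<rat>(\<surd>D)\<close>. The elements
  \<open>p a + b \<surd>D\<close> with \<open>a \<equiv> b (mod 2)\<close> form an ideal of the full ring of integers, whatever \<open>D\<close> is
  modulo 4. Up to a common scaling its lattice consists of the \<open>a u + b v\<close> with \<open>u\<close> orthogonal to
  \<open>v\<close>, \<open>|u|\<^sup>2 = p\<^sup>2\<close>, \<open>|v|\<^sup>2 = |D|\<close> and \<open>a \<equiv> b (mod 2)\<close>, both for \<open>D > 0\<close> and for \<open>D < 0\<close>. If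
  \<open>p/3 \<le> |q| \<le> 3p\<close>, then \<open>\<plusminus>u \<plusminus> v\<close> are minimal vectors, so the lattice is well-rounded.
  Infinitely many such \<open>D\<close> of each sign arise from a prime \<open>p\<close> and an odd squarefree \<open>|q|\<close> between
  \<open>p\<close> and \<open>3p\<close>, whose existence follows by counting the multiples of odd squares.
\<close>

section \<open>Squarefree numbers and quadratic integers\<close>

lemma card_congruent_le:
  fixes B :: "nat set"
  assumes "d > 0" "B \<subseteq> {..<n}" "\<And>i j. i \<in> B \<Longrightarrow> j \<in> B \<Longrightarrow> i \<le> j \<Longrightarrow> d dvd j - i"
  shows "card B \<le> n div d + 1"
proof -
  \<comment> \<open>Cut the range into blocks of length \<open>d\<close>: two members of
    \<open>B\<close> in one block would differ by less than \<open>d\<close>. Block numbers run from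
    0 to \<open>n div d\<close>, hence the extra 1 in the bound.\<close>
  have "inj_on (\<lambda>i. i div d) B"
  proof (rule linorder_inj_onI)
    fix i j assume ij: "i < j" "i \<in> B" "j \<in> B"
    then have "d \<le> j - i" using assms(3)[of i j] by (intro dvd_imp_le) auto
    then have "i + d \<le> j" using ij by simp
    then have "(i + d) div d \<le> j div d" by (rule div_le_mono)
    then show "i div d \<noteq> j div d" using assms(1) by simp
  qed auto
  moreover have "(\<lambda>i. i div d) ` B \<subseteq> {..n div d}"
    using assms(2) by (auto intro!: div_le_mono)
  ultimately show ?thesis
    using card_inj_on_le[of _ B "{..n div d}"] by simp
qed

text \<open>Telescoping: (2j + 1)^2 >= 4j(j + 1), so the j-th term is at most 1/(4j) - 1/(4(j + 1)).
  The total stays below 1/4, small enough for the sieve to leave something over.\<close>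

lemma sum_inverse_odd_squares_le:
  "(\<Sum>j=1..J. 1 / (2 * real j + 1)\<^sup>2) \<le> 1 / 4 - 1 / (4 * (real J + 1))"
proof (induction J)
  case (Suc J)
  have "1 / (2 * real (Suc J) + 1)\<^sup>2 \<le> 1 / (4 * (real J + 1)) - 1 / (4 * (real (Suc J) + 1))"
    by (simp add: divide_simps power2_eq_square) (simp add: algebra_simps)
  with Suc show ?case by simp
qed simp

text \<open>
  The odd numbers strictly between \<open>p\<close> and \<open>3p\<close> are \<open>p + 2i\<close> with \<open>0 < i < p\<close>; those divisible by
  \<open>(2j + 1)\<^sup>2\<close> make up one residue class of \<open>i\<close>, hence at most \<open>p / (2j + 1)\<^sup>2 + 1\<close> of them.
\<close>

lemma ex_odd_squarefree_between:
  fixes p :: nat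
  assumes "odd p" "p \<ge> 16"
  obtains q where "odd q" "squarefree q" "p < q" "q < 3 * p"
proof -
  \<comment> \<open>A square (2j + 1)^2 dividing p + 2i < 3p has 4j^2 < 3p, hence j^2 <= p, so it
    suffices to sieve with j up to the integer part of sqrt p.\<close>
  define J where "J = nat \<lfloor>sqrt (real p)\<rfloor>"
  define B where "B j = {i \<in> {1..<p}. (2 * j + 1)\<^sup>2 dvd p + 2 * i}" for j
  have B_finite: "finite (B j)" for j unfolding B_def by simp
  have card_B: "real (card (B j)) \<le> real p * (1 / (2 * real j + 1)\<^sup>2) + 1" for j
  proof -
    have "card (B j) \<le> p div (2 * j + 1)\<^sup>2 + 1"
    proof (rule card_congruent_le)
      fix i k assume "i \<in> B j" "k \<in> B j" "i \<le> k"
      then have "(2 * j + 1)\<^sup>2 dvd (p + 2 * k) - (p + 2 * i)"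
        by (intro dvd_diff_nat) (auto simp: B_def)
      also have "(p + 2 * k) - (p + 2 * i) = 2 * (k - i)" by simp
      \<comment> \<open>The odd square is coprime to the factor 2.\<close>
      finally show "(2 * j + 1)\<^sup>2 dvd k - i"
        by (subst (asm) coprime_dvd_mult_right_iff) auto
    qed (auto simp: B_def)
    then have "real (card (B j)) \<le> real (p div (2 * j + 1)\<^sup>2) + 1" by linarith
    also have "real (p div (2 * j + 1)\<^sup>2) \<le> real p / real ((2 * j + 1)\<^sup>2)"
      by (rule of_nat_div_le_of_nat)
    finally show ?thesis by (simp add: add.commute)
  qed
  have "real (card (\<Union>j\<in>{1..J}. B j)) \<le> (\<Sum>j=1..J. real (card (B j)))"
    unfolding of_nat_sum[symmetric] of_nat_le_iff by (rule card_UN_le) simp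
  also have "\<dots> \<le> (\<Sum>j=1..J. real p * (1 / (2 * real j + 1)\<^sup>2) + 1)"
    by (intro sum_mono card_B)
  also have "\<dots> = real p * (\<Sum>j=1..J. 1 / (2 * real j + 1)\<^sup>2) + real J"
    by (simp add: sum.distrib sum_distrib_left)
  also have "\<dots> \<le> real p * (1 / 4) + sqrt (real p)"
  proof (intro add_mono mult_left_mono)
    show "(\<Sum>j=1..J. 1 / (2 * real j + 1)\<^sup>2) \<le> 1 / 4"
      using sum_inverse_odd_squares_le[of J] by (smt (verit) divide_nonneg_nonneg of_nat_0_le_iff)
    show "real J \<le> sqrt (real p)" unfolding J_def by simp
  qed simp
  \<comment> \<open>Here \<open>p\<close> being at least 16 enters: the rounding errors, one per
    sieving square, sum to at most p/4. The sieve thus removes at most p/2 of the p - 1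
    candidates.\<close>
  also have "sqrt (real p) \<le> real p / 4"
  proof (rule real_le_lsqrt)
    have "16 * real p \<le> real p * real p" using assms(2) by (intro mult_right_mono) auto
    then show "real p \<le> (real p / 4)\<^sup>2" by (simp add: power2_eq_square)
  qed simp
  also have "real p * (1 / 4) + real p / 4 < real (p - 1)"
    using assms(2) by (simp add: of_nat_diff)
  finally have "card (\<Union>j\<in>{1..J}. B j) < card {1..<p}" by simp
  then have "\<not> {1..<p} \<subseteq> (\<Union>j\<in>{1..J}. B j)"
    by (meson B_finite card_mono finite_UN_I finite_atLeastAtMost not_le)
  then obtain i where i: "i \<in> {1..<p}" "\<And>j. j \<in> {1..J} \<Longrightarrow> \<not> (2 * j + 1)\<^sup>2 dvd p + 2 * i"
    unfolding B_def by blast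
  show ?thesis
  proof (rule that[of "p + 2 * i"])
    show odd: "odd (p + 2 * i)" using assms(1) by simp
    show "p < p + 2 * i" "p + 2 * i < 3 * p" using i(1) by auto
    show "squarefree (p + 2 * i)"
    proof (rule squarefreeI, rule ccontr)
      fix k :: nat assume k: "k\<^sup>2 dvd p + 2 * i" "\<not> k dvd 1"
      then have "odd k" using odd by (metis dvd_trans dvd_power zero_less_numeral)
      then obtain j where j: "k = 2 * j + 1" by (elim oddE)
      have "k\<^sup>2 \<le> p + 2 * i" using k(1) i(1) by (intro dvd_imp_le) auto
      then have "4 * j\<^sup>2 < 3 * p" using i(1) j by (simp add: power2_eq_square)
      then have "j\<^sup>2 \<le> p" by linarith
      then have "real j \<le> sqrt (real p)"
        by (metis of_nat_le_iff of_nat_power real_le_rsqrt)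
      then have "j \<le> J" unfolding J_def by (simp add: le_nat_iff le_floor_iff)
      moreover have "j \<noteq> 0" using k(2) j by auto
      ultimately show False using i(2)[of j] k(1) j by auto
    qed
  qed
qed

lemma squarefree_int:
  assumes "squarefree n"
  shows "squarefree (int n)"
proof (rule squarefreeI)
  fix x assume "x\<^sup>2 dvd int n"
  then have "(nat \<bar>x\<bar>)\<^sup>2 dvd n"
    by (simp flip: int_dvd_int_iff)
  then have "nat \<bar>x\<bar> dvd 1" using assms by (rule squarefreeD[rotated])
  then show "x dvd 1" by auto
qed

text \<open>A prime \<open>p\<close> beyond the maximum of a finite set of this kind, multiplied by
  a \<open>q\<close> from \<open>ex_odd_squarefree_between\<close>, gives a member exceeding that
  maximum.\<close>

lemma infinite_squarefree_balanced_products: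
  "infinite {D::int. squarefree D \<and> (\<exists>p q. D = p * q \<and> odd p \<and> odd q \<and> 0 < p \<and> p < q \<and> q < 3 * p)}"
  (is "infinite ?S")
proof
  assume fin: "finite ?S"
  obtain p :: nat where p: "Factorial_Ring.prime p" "p > max 16 (nat (Max ?S))" using bigger_prime by blast
  have "odd p" using p prime_odd_nat by auto
  then obtain q where q: "odd q" "squarefree q" "p < q" "q < 3 * p"
    using ex_odd_squarefree_between[of p] p(2) by auto
  \<comment> \<open>The only multiple of \<open>p\<close> strictly between \<open>p\<close> and
    \<open>3 * p\<close> is the even number \<open>2 * p\<close>. The coprimality obtained here
    makes the product squarefree.\<close>
  have "\<not> p dvd q"
  proof
    assume "p dvd q"
    then obtain k where k: "q = p * k" by blast
    then have "1 < k" "k < 3" using q by auto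
    then have "k = 2" by simp
    then show False using k q by simp
  qed
  then have "squarefree (p * q)"
    using p q by (intro squarefree_mult_coprime) (auto intro: prime_imp_coprime squarefree_prime)
  then have "squarefree (int (p * q))"
    by (rule squarefree_int)
  moreover have "int (p * q) = int p * int q \<and> odd (int p) \<and> odd (int q) \<and> 0 < int p \<and> int p < int q \<and> int q < 3 * int p"
    using p q \<open>odd p\<close> by auto
  ultimately have "int (p * q) \<in> ?S" by blast
  then have "int (p * q) \<le> Max ?S" using fin by (rule Max_ge[rotated])
  moreover have "p * 1 \<le> p * q" using q by (intro mult_le_mono) auto
  ultimately show False using p(2) by linarith
qed

section \<open>Integrality of coefficients\<close>

lemma squarefree_times_square_in_Ints:
  fixes r :: "'a :: field_char_0"
  assumes "squarefree D" "r \<in> \<rat>" "of_int D * r\<^sup>2 \<in> \<int>"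
  shows "r \<in> \<int>"
proof -
  \<comment> \<open>In lowest terms the squared denominator divides D a^2 and is coprime to a^2, so
    it divides the squarefree \<open>D\<close>.\<close>
  obtain a b where ab: "b > 0" "coprime a b" "r = of_int a / of_int b"
    using assms(2) by (rule Rats_cases')
  obtain z where "of_int D * r\<^sup>2 = of_int z" using assms(3) by (elim Ints_cases)
  then have "of_int (D * a\<^sup>2) = (of_int (z * b\<^sup>2) :: 'a)"
    using ab by (simp add: field_simps power_divide)
  then have "D * a\<^sup>2 = z * b\<^sup>2" by (simp only: of_int_eq_iff)
  then have "b\<^sup>2 dvd D * a\<^sup>2" by simp
  then have "b\<^sup>2 dvd D"
    using ab(2) by (subst (asm) coprime_dvd_mult_left_iff) (auto simp: coprime_commute)
  then have "b dvd 1" using assms(1) by (rule squarefreeD[rotated])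
  then show ?thesis using ab by simp
qed

text \<open>Gauss's lemma: as \<open>x\<close> is irrational, X^2 - tX + n is its minimal polynomial
  over the rationals. The primitive integer multiple of it then divides a monic integer polynomial,
  so its leading coefficient is a unit and \<open>t\<close>, \<open>n\<close> have trivial
  denominators.\<close>

lemma algebraic_int_quadratic_coeffs:
  fixes x t n :: "'a :: field_char_0"
  assumes "algebraic_int x" "x\<^sup>2 - t * x + n = 0" "t \<in> \<rat>" "n \<in> \<rat>" "x \<notin> \<rat>"
  shows "t \<in> \<int>" "n \<in> \<int>"
proof -
  let ?ev = "\<lambda>f::int poly. poly (map_poly of_int f) x"
  obtain P :: "int poly" where P: "?ev P = 0" "Polynomial.lead_coeff P = 1"
    using assms(1) by (auto simp: algebraic_int_altdef_ipoly)
  obtain a b where t: "b > 0" "t = of_int a / of_int b" using assms(3) by (rule Rats_cases')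
  obtain c d where n: "d > 0" "n = of_int c / of_int d" using assms(4) by (rule Rats_cases')
  \<comment> \<open>\<open>b * d\<close> times X^2 - tX + n, with denominators cleared.\<close>
  define G0 where "G0 = [:c * b, - (a * d), b * d:]"
  define G where "G = primitive_part G0"
  have G0: "G0 = Polynomial.smult (content G0) G" unfolding G_def by simp
  have c0: "content G0 \<noteq> 0" using t n by (simp add: G0_def)
  have ev_smult: "?ev (Polynomial.smult k f) = of_int k * ?ev f" for k f
    by (simp add: map_poly_smult)
  have ev_add: "?ev (f + g) = ?ev f + ?ev g" for f g
  proof -
    have "map_poly of_int (f + g) = map_poly of_int f + (map_poly of_int g :: 'a poly)"
      by (simp add: poly_eq_iff coeff_map_poly)
    then show ?thesis by simp
  qed
  have ev_mult: "?ev (f * g) = ?ev f * ?ev g" for f g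
    by (induction f) (simp_all add: ev_add ev_smult map_poly_pCons algebra_simps)
  have "?ev G0 = of_int (b * d) * (x\<^sup>2 - t * x + n)"
    using t n by (simp add: G0_def map_poly_pCons power2_eq_square field_simps)
  then have "of_int (content G0) * ?ev G = 0"
    using assms(2) by (subst (asm) G0) (simp add: ev_smult)
  then have G: "?ev G = 0" using c0 by simp
  have degG: "Polynomial.degree G = 2" using t n c0 by (simp add: G_def G0_def)
  \<comment> \<open>Pseudo-division stays over the integers at the price of the factor
    \<open>k\<close>. The remainder has degree below 2 and vanishes at the irrational
    \<open>x\<close>, so it is zero.\<close>
  obtain k q where k: "k \<noteq> 0" "Polynomial.smult k P = G * q + pseudo_mod P G"
    using pseudo_mod(1)[of G P] degG by fastforce
  define R where "R = pseudo_mod P G"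
  have "Polynomial.degree R < 2" using pseudo_mod(2)[of G P] degG by (force simp: R_def)
  then obtain r0 r1 where R: "R = [:r0, r1:]"
    by (metis degree_pCons_eq_if less_2_cases pCons_cases degree_0 Suc_1 less_Suc0 not_less_eq degree_eq_zeroE)
  have "?ev (Polynomial.smult k P) = ?ev G * ?ev q + ?ev R"
    unfolding k(2) R_def[symmetric] by (simp add: ev_add ev_mult)
  then have "?ev R = 0" using P G by (simp add: ev_smult)
  then have r: "of_int r0 + x * of_int r1 = 0" by (simp add: R map_poly_pCons)
  have "r1 = 0"
  proof (rule ccontr)
    assume "r1 \<noteq> 0"
    then have "x = - of_int r0 / of_int r1" using r by (simp add: field_simps add_eq_0_iff)
    then show False using assms(5) by simp
  qed
  then have "R = 0" using r by (simp add: R)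
  then have eq: "Polynomial.smult k P = G * q" using k by (simp add: R_def)
  \<comment> \<open>Since \<open>G\<close> is primitive, multiplicativity of the content pushes
    \<open>k\<close> entirely into \<open>q\<close>, where it cancels.\<close>
  have cG: "content G = 1" using c0 by (simp add: G_def)
  have "k dvd content (Polynomial.smult k P)" by simp
  then have "k dvd content q" unfolding eq content_mult cG by simp
  then have "[:k:] dvd q" by (simp add: const_poly_dvd_iff_dvd_content)
  then obtain q' where "q = [:k:] * q'" by (elim dvdE)
  then have "q = Polynomial.smult k q'" by simp
  then have "Polynomial.smult k P = Polynomial.smult k (G * q')" using eq by simp
  then have "P = G * q'" using k(1) by (simp add: poly_eq_iff)
  \<comment> \<open>Hence \<open>b * d\<close>, the leading coefficient of \<open>G0\<close>, is up
    to sign the content of \<open>G0\<close> and divides the other coefficients.\<close>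
  then have "Polynomial.lead_coeff G dvd 1" using P(2) by (metis dvd_triv_left lead_coeff_mult)
  moreover have "b * d = content G0 * Polynomial.lead_coeff G"
    using arg_cong[OF G0, of Polynomial.lead_coeff] t n by (simp add: G0_def)
  ultimately have bd: "b * d dvd content G0"
    by (metis dvd_refl mult_dvd_mono mult.right_neutral mult_unit_dvd_iff)
  have "b * d dvd Polynomial.coeff G0 i" for i
    using bd content_dvd_coeff dvd_trans by blast
  from this[of 0] this[of 1] have "b * d dvd c * b" "b * d dvd a * d"
    by (simp_all add: G0_def)
  then have "d dvd c" "b dvd a" using t n by (simp_all add: mult.commute)
  then show "t \<in> \<int>" "n \<in> \<int>" using t n by (auto elim!: dvdE)
qed

section \<open>Quadratic fields\<close>

text \<open>The principal root \<open>csqrt\<close> covers both signs: it is real for positive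
  \<open>D\<close> and a positive multiple of the imaginary unit for negative
  \<open>D\<close>.\<close>

definition sqrt_field :: "int \<Rightarrow> complex set"
  where "sqrt_field D = {a + b * csqrt (of_int D) | a b. a \<in> \<rat> \<and> b \<in> \<rat>}"

lemma complex_ring_simps [simp]:
  "carrier complex_ring = UNIV" "x \<otimes>\<^bsub>complex_ring\<^esub> y = x * y" "x \<oplus>\<^bsub>complex_ring\<^esub> y = x + y"
  "\<zero>\<^bsub>complex_ring\<^esub> = 0" "\<one>\<^bsub>complex_ring\<^esub> = 1"
  by (simp_all add: ring_of_type_algebra_def)

lemma complex_ring_a_inv [simp]: "\<ominus>\<^bsub>complex_ring\<^esub> x = - x"
proof -
  interpret field complex_ring by (rule field_from_type_algebra)
  show ?thesis by (rule minus_equality) simp_all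
qed

lemma complex_ring_inv: "x \<noteq> 0 \<Longrightarrow> inv\<^bsub>complex_ring\<^esub> x = inverse x"
proof -
  interpret field complex_ring by (rule field_from_type_algebra)
  show "x \<noteq> 0 \<Longrightarrow> inv\<^bsub>complex_ring\<^esub> x = inverse x" by (intro comm_inv_char) simp_all
qed

text \<open>Among squarefree integers only 1 is a perfect square, so excluding it makes the root
  irrational.\<close>

locale squarefree_radicand =
  fixes D :: int
  assumes squarefree: "squarefree D" and not_1: "D \<noteq> 1"
begin

abbreviation s :: complex where "s \<equiv> csqrt (of_int D)"

abbreviation K :: "complex set" where "K \<equiv> sqrt_field D"

lemma nonzero: "D \<noteq> 0"
  using squarefree by auto

lemma s_square: "s * s = of_int D"
  using power2_csqrt[of "of_int D"] by (simp add: power2_eq_square)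

lemma s_nonzero: "s \<noteq> 0"
  using nonzero by simp

lemma s_irrational: "s \<notin> \<rat>"
proof
  assume "s \<in> \<rat>"
  moreover have "algebraic_int s" by (intro algebraic_int_csqrt) simp
  ultimately obtain z where "s = of_int z"
    by (metis Ints_cases rational_algebraic_int_is_int)
  then have "of_int (z * z) = (of_int D :: complex)" using s_square by simp
  then have "z * z = D" by (simp only: of_int_eq_iff)
  moreover from this have "z dvd 1" using squarefree by (intro squarefreeD) (auto simp: power2_eq_square)
  ultimately show False using not_1 by (auto simp: zdvd1_eq abs_if split: if_splits)
qed

lemma mem_I: "a \<in> \<rat> \<Longrightarrow> b \<in> \<rat> \<Longrightarrow> a + b * s \<in> K"
  by (auto simp: sqrt_field_def)

lemma mem_E:
  assumes "x \<in> K" obtains a b where "x = a + b * s" "a \<in> \<rat>" "b \<in> \<rat>"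
  using assms by (auto simp: sqrt_field_def)

lemma rats_subset: "\<rat> \<subseteq> K"
  using mem_I[of _ 0] by auto

lemma s_mem: "s \<in> K"
  using mem_I[of 0 1] by auto

lemma eq_0_imp:
  assumes "a \<in> \<rat>" "b \<in> \<rat>" "a + b * s = 0"
  shows "a = 0 \<and> b = 0"
proof -
  have "b = 0"
  proof (rule ccontr)
    assume "b \<noteq> 0"
    then have "s = - a / b" using assms(3) by (subst eq_divide_eq) (simp add: add_eq_0_iff mult.commute)
    then show False using assms s_irrational by simp
  qed
  then show ?thesis using assms by simp
qed

lemma eq_imp:
  assumes "a \<in> \<rat>" "b \<in> \<rat>" "c \<in> \<rat>" "d \<in> \<rat>" "a + b * s = c + d * s"
  shows "a = c \<and> b = d"
  using eq_0_imp[of "a - c" "b - d"] assms by (auto simp: algebra_simps)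

lemma mult_mem:
  assumes "x = a + b * s" "y = c + d * s"
  shows "x * y = (a * c + of_int D * b * d) + (a * d + b * c) * s"
proof -
  have "x * y = a * c + b * d * (s * s) + (a * d + b * c) * s"
    unfolding assms by (simp add: algebra_simps)
  then show ?thesis unfolding s_square by (simp add: algebra_simps)
qed

lemma subfield: "subfield K complex_ring"
proof -
  interpret field complex_ring by (rule field_from_type_algebra)
  have "subring K complex_ring"
  proof (rule subringI)
    show "K \<subseteq> carrier complex_ring" "\<one>\<^bsub>complex_ring\<^esub> \<in> K" using rats_subset by auto
    fix x assume "x \<in> K"
    then obtain a b where x: "x = a + b * s" "a \<in> \<rat>" "b \<in> \<rat>" by (rule mem_E)
    have "- x = - a + (- b) * s" using x by simp
    moreover have "\<dots> \<in> K" using x by (intro mem_I) auto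
    ultimately show "\<ominus>\<^bsub>complex_ring\<^esub> x \<in> K" by simp
    fix y assume "y \<in> K"
    then obtain c d where y: "y = c + d * s" "c \<in> \<rat>" "d \<in> \<rat>" by (rule mem_E)
    have "x * y \<in> K" unfolding mult_mem[OF x(1) y(1)] using x y by (intro mem_I) auto
    then show "x \<otimes>\<^bsub>complex_ring\<^esub> y \<in> K" by simp
    have "x + y = (a + c) + (b + d) * s" using x y by (simp add: algebra_simps)
    moreover have "\<dots> \<in> K" using x y by (intro mem_I) auto
    ultimately show "x \<oplus>\<^bsub>complex_ring\<^esub> y \<in> K" by simp
  qed
  then show ?thesis
  proof (rule subfieldI')
    fix x assume "x \<in> K - {\<zero>\<^bsub>complex_ring\<^esub>}"
    then obtain a b where x: "x = a + b * s" "a \<in> \<rat>" "b \<in> \<rat>" "x \<noteq> 0" by (auto elim: mem_E)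
    \<comment> \<open>The norm of \<open>x\<close>. The conjugate divided by the norm is the
      inverse.\<close>
    define n where "n = a * a - of_int D * b * b"
    have n: "x * (a + (- b) * s) = n" using mult_mem[OF x(1), of _ a "- b"] by (simp add: n_def)
    have "a + (- b) * s \<noteq> 0" using eq_0_imp[of a "- b"] x by auto
    then have "n \<noteq> 0" using n x(4) by (metis mult_eq_0_iff)
    moreover have "x * (a / n + (- b / n) * s) = x * (a + (- b) * s) / n"
      by (simp add: algebra_simps diff_divide_distrib)
    ultimately have "inverse x = a / n + (- b / n) * s" unfolding n by (intro inverse_unique) simp
    also have "\<dots> \<in> K" using x unfolding n_def by (intro mem_I) auto
    finally show "inv\<^bsub>complex_ring\<^esub> x \<in> K" using x(4) by (simp add: complex_ring_inv)
  qed
qed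

lemma quadratic_field: "quadratic_field K"
proof -
  interpret field complex_ring by (rule field_from_type_algebra)
  \<comment> \<open>The rationals have dimension one over themselves, and adjoining the line through
    the irrational \<open>s\<close> adds one.\<close>
  have "dimension (Suc 1) \<rat> (line_extension \<rat> s \<rat>)"
    using s_irrational dimension_one[OF rats_subfield] by (intro Suc_dim) auto
  also have "line_extension \<rat> s \<rat> = K"
    by (auto simp: line_extension_mem_iff sqrt_field_def add.commute) blast+
  finally have dim: "dimension 2 \<rat> K" by (simp add: numeral_2_eq_2)
  show ?thesis
    unfolding quadratic_field_def number_field_def field_degree_def
    using subfield finite_dimensionI[OF dim] dimI[OF rats_subfield dim] by (simp add: over_def)
qed

section \<open>Conjugation and the two embeddings\<close>

definition conj :: "complex \<Rightarrow> complex"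
  where "conj x = (THE y. \<exists>a\<in>\<rat>. \<exists>b\<in>\<rat>. x = a + b * s \<and> y = a - b * s)"

lemma conj_eq:
  assumes "a \<in> \<rat>" "b \<in> \<rat>"
  shows "conj (a + b * s) = a - b * s"
  \<comment> \<open>Uniqueness of coordinates, \<open>eq_imp\<close>, makes the definite description
    meaningful on \<open>K\<close>. Outside \<open>K\<close> the value is arbitrary, so the
    embedding has to be \<open>restrict conj K\<close>.\<close>
  unfolding conj_def using assms eq_imp by (intro the_equality) (blast, metis)

lemma embeddings_apply:
  assumes "h \<in> embeddings K" "a \<in> \<rat>" "b \<in> \<rat>"
  shows "h (a + b * s) = a + b * h s"
proof -
  have h: "h \<in> ring_hom (complex_ring\<lparr>carrier := K\<rparr>) complex_ring"
    using assms(1) by (simp add: embeddings_def)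
  have "a \<in> K" "b \<in> K" "b * s \<in> K" using assms(2,3) rats_subset mem_I[of 0 b] by auto
  then show ?thesis
    using hom_simps(2,3)[OF h] hom_fixes_rats[OF subfield h _ rats_subset] assms(2,3) s_mem by simp
qed

text \<open>An embedding fixes the rationals, so it is determined by the image of \<open>s\<close>,
  which must again be a square root of \<open>D\<close>.\<close>

lemma embeddings_eq: "embeddings K = {restrict id K, restrict conj K}"
proof (intro equalityI subsetI)
  fix h assume h: "h \<in> embeddings K"
  then have hom: "h \<in> ring_hom (complex_ring\<lparr>carrier := K\<rparr>) complex_ring" and ext: "h \<in> extensional K"
    by (simp_all add: embeddings_def)
  have "h s * h s = h (of_int D + 0 * s)"
    using hom_simps(3)[OF hom s_mem s_mem] s_square by simp
  also have "\<dots> = s * s" unfolding s_square by (subst embeddings_apply[OF h]) auto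
  finally have "h s = s \<or> h s = - s" by (simp only: square_eq_iff)
  then show "h \<in> {restrict id K, restrict conj K}"
  proof
    assume hs: "h s = s"
    have "h = restrict id K"
    proof (rule extensionalityI[OF ext])
      fix x assume "x \<in> K"
      then show "h x = restrict id K x"
        using embeddings_apply[OF h] hs by (auto elim!: mem_E)
    qed auto
    then show ?thesis by simp
  next
    assume hs: "h s = - s"
    have "h = restrict conj K"
    proof (rule extensionalityI[OF ext])
      fix x assume x: "x \<in> K"
      then obtain a b where "x = a + b * s" "a \<in> \<rat>" "b \<in> \<rat>" by (rule mem_E)
      then show "h x = restrict conj K x"
        using embeddings_apply[OF h, of a b] hs x conj_eq[of a b] by simp
    qed auto
    then show ?thesis by simp
  qed
next
  note closed = subfield_closed[OF subfield]
  fix h assume "h \<in> {restrict id K, restrict conj K}"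
  then show "h \<in> embeddings K"
  proof (elim insertE emptyE)
    assume "h = restrict id K"
    then show ?thesis using closed by (auto simp: embeddings_def ring_hom_def)
  next
    assume h: "h = restrict conj K"
    have "conj 1 = 1" using conj_eq[of 1 0] by simp
    moreover have "conj (x + y) = conj x + conj y \<and> conj (x * y) = conj x * conj y"
      if xy: "x \<in> K" "y \<in> K" for x y
    proof -
      obtain a b where x: "x = a + b * s" "a \<in> \<rat>" "b \<in> \<rat>" using xy(1) by (rule mem_E)
      obtain c d where y: "y = c + d * s" "c \<in> \<rat>" "d \<in> \<rat>" using xy(2) by (rule mem_E)
      have "x + y = (a + c) + (b + d) * s" using x y by (simp add: algebra_simps)
      then have "conj (x + y) = (a + c) - (b + d) * s"
        using x y by (simp only: conj_eq Rats_add)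
      moreover have "conj (x * y) = (a * c + of_int D * b * d) - (a * d + b * c) * s"
        unfolding mult_mem[OF x(1) y(1)] using x y by (intro conj_eq) auto
      moreover have cx: "conj x = a + (- b) * s" and cy: "conj y = c + (- d) * s"
        using x y conj_eq by auto
      moreover have "conj x * conj y = (a * c + of_int D * b * d) - (a * d + b * c) * s"
        unfolding mult_mem[OF cx cy] by (simp add: algebra_simps)
      moreover have "(a + (- b) * s) + (c + (- d) * s) = (a + c) - (b + d) * s"
        by (simp add: algebra_simps)
      ultimately show ?thesis by (simp only:)
    qed
    ultimately show ?thesis using h closed by (auto simp: embeddings_def ring_hom_def)
  qed
qed

lemma conj_s: "conj s = - s"
  using conj_eq[of 0 1] by simp

lemma embeddings_distinct: "restrict id K \<noteq> restrict conj K"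
proof
  assume "restrict id K = restrict conj K"
  then have "s = - s"
    using fun_cong[of _ _ s] s_mem conj_s by (metis restrict_apply' id_apply)
  then have "2 * s = 0" by (simp only: eq_neg_iff_add_eq_0 mult_2)
  then show False using s_nonzero by (simp only: mult_eq_0_iff) simp
qed

text \<open>The element with coordinates m/2, n/2 has trace m and norm (m^2 - D n^2)/4. The single
  congruence replaces the usual case split on \<open>D\<close> modulo 4.\<close>

lemma algebraic_int_iff:
  "x \<in> K \<and> algebraic_int x \<longleftrightarrow>
     (\<exists>m n :: int. x = (of_int m + of_int n * s) / 2 \<and> 4 dvd m\<^sup>2 - D * n\<^sup>2)"
proof (intro iffI; (elim conjE exE)?)
  assume "x \<in> K" and alg: "algebraic_int x"
  then obtain a b where x: "x = a + b * s" "a \<in> \<rat>" "b \<in> \<rat>" by (auto elim: mem_E)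
  show "\<exists>m n :: int. x = (of_int m + of_int n * s) / 2 \<and> 4 dvd m\<^sup>2 - D * n\<^sup>2"
  proof (cases "b = 0")
    \<comment> \<open>A rational \<open>x\<close> falls outside the minimal polynomial argument, but
      a rational algebraic integer is an integer.\<close>
    case True
    then obtain m where "x = of_int m"
      using alg x by (metis Ints_cases add.right_neutral mult_zero_left rational_algebraic_int_is_int)
    then show ?thesis by (intro exI[of _ "2 * m"] exI[of _ 0]) (simp add: power_mult_distrib)
  next
    case False
    have "x \<notin> \<rat>"
    proof
      assume "x \<in> \<rat>"
      moreover have "a + b * s = x + 0 * s" using x(1) by simp
      ultimately show False using eq_imp[OF x(2,3) _ Rats_0] False by blast
    qed
    moreover have "x\<^sup>2 - (2 * a) * x + (a\<^sup>2 - of_int D * b\<^sup>2) = 0"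
      unfolding power2_eq_square mult_mem[OF x(1) x(1)] by (simp add: x(1) algebra_simps)
    ultimately have "2 * a \<in> \<int>" "a\<^sup>2 - of_int D * b\<^sup>2 \<in> \<int>"
      using algebraic_int_quadratic_coeffs[OF alg, of "2 * a" "a\<^sup>2 - of_int D * b\<^sup>2"] x(2,3)
      by simp_all
    then obtain m k where m: "2 * a = of_int m" and k: "a\<^sup>2 - of_int D * b\<^sup>2 = of_int k"
      by (elim Ints_cases)
    \<comment> \<open>Integrality of trace and norm makes D(2b)^2 an integer, and squarefreeness of
      \<open>D\<close> then gives integrality of 2b.\<close>
    have "of_int D * (2 * b)\<^sup>2 = (2 * a)\<^sup>2 - 4 * (a\<^sup>2 - of_int D * b\<^sup>2)"
      by (simp add: power_mult_distrib algebra_simps)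
    also have "\<dots> = of_int (m\<^sup>2 - 4 * k)" unfolding m k by simp
    finally have D: "of_int D * (2 * b)\<^sup>2 = of_int (m\<^sup>2 - 4 * k)" .
    have "2 * b \<in> \<int>"
    proof (rule squarefree_times_square_in_Ints[OF squarefree])
      show "2 * b \<in> \<rat>" using x(3) by simp
      show "of_int D * (2 * b)\<^sup>2 \<in> \<int>" unfolding D by (rule Ints_of_int)
    qed
    then obtain n where n: "2 * b = of_int n" by (elim Ints_cases)
    have "of_int (D * n\<^sup>2) = (of_int (m\<^sup>2 - 4 * k) :: complex)" unfolding D[symmetric] n by simp
    then have "D * n\<^sup>2 = m\<^sup>2 - 4 * k" by (simp only: of_int_eq_iff)
    then have "4 dvd m\<^sup>2 - D * n\<^sup>2" by simp
    moreover have "x = (of_int m + of_int n * s) / 2"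
      unfolding m[symmetric] n[symmetric] x(1) by simp
    ultimately show ?thesis by blast
  qed
next
  fix m n :: int
  assume x: "x = (of_int m + of_int n * s) / 2" and "4 dvd m\<^sup>2 - D * n\<^sup>2"
  then obtain k where k: "m\<^sup>2 - D * n\<^sup>2 = 4 * k" by (elim dvdE)
  have x': "x = of_int m / 2 + (of_int n / 2) * s" using x by (simp add: add_divide_distrib)
  have "of_int (m\<^sup>2 - D * n\<^sup>2) = (of_int (4 * k) :: complex)" using k by (simp only:)
  then have k': "of_int k = (of_int m * of_int m - of_int D * of_int n * of_int n) / (4 :: complex)"
    by (simp add: power2_eq_square algebra_simps)
  have "poly [:of_int k, - of_int m, 1:] x = of_int k - of_int m * x + x * x"
    by (simp add: algebra_simps)
  also have "\<dots> = 0"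
    unfolding mult_mem[OF x' x'] k' by (simp add: x' field_simps)
  finally have "poly [:of_int k, - of_int m, 1:] x = 0" .
  moreover have "Polynomial.coeff [:of_int k, - of_int m, 1:] i \<in> (\<int> :: complex set)" for i
    by (auto simp: coeff_pCons split: nat.splits)
  ultimately have "algebraic_int x" by (intro algebraic_int.intros) auto
  moreover have "x \<in> K" unfolding x' by (intro mem_I) auto
  ultimately show "x \<in> K \<and> algebraic_int x" by blast
qed

end

section \<open>Centered rectangular lattices\<close>

text \<open>By orthogonality the squared norm is a^2 |u|^2 + b^2 |v|^2. If both coefficients are
  nonzero this is at least |u|^2 + |v|^2. If one vanishes, the other is even and the value is at
  least 4|u|^2 or 4|v|^2, which the factor 3 in the hypotheses makes large enough.\<close>

lemma well_rounded_centered_rectangular: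
  fixes u v :: "'a::euclidean_space"
  assumes dim: "DIM('a) = 2" and orth: "u \<bullet> v = 0" and u: "u \<noteq> 0" and v: "v \<noteq> 0"
    and uv: "(norm u)\<^sup>2 \<le> 3 * (norm v)\<^sup>2" and vu: "(norm v)\<^sup>2 \<le> 3 * (norm u)\<^sup>2"
  shows "well_rounded {of_int a *\<^sub>R u + of_int b *\<^sub>R v | a b. even (a - b)}" (is "well_rounded ?L")
proof -
  let ?x = "u + v" and ?y = "u - v"
  have norm: "(norm (of_int a *\<^sub>R u + of_int b *\<^sub>R v))\<^sup>2
      = of_int (a\<^sup>2) * (norm u)\<^sup>2 + of_int (b\<^sup>2) * (norm v)\<^sup>2" for a b :: int
    using orth unfolding power2_norm_eq_inner
    by (simp add: inner_add_left inner_add_right inner_commute[of v u] power2_eq_square)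
  have pos: "(norm u)\<^sup>2 > 0" "(norm v)\<^sup>2 > 0" using u v by simp_all
  have "u \<noteq> v" using orth u by auto
  have "?x \<noteq> ?y" using v by (simp add: eq_diff_eq flip: scaleR_2)
  have spanxy: "span {?x, ?y} = UNIV"
  proof -
    have "Real_Vector_Spaces.independent {u, v}"
      using orth u v by (intro pairwise_orthogonal_independent)
        (auto simp: pairwise_def orthogonal_def inner_commute)
    then have "(UNIV :: 'a set) \<subseteq> span {u, v}"
      using dim \<open>u \<noteq> v\<close> by (intro card_ge_dim_independent) auto
    also have "span {u, v} \<subseteq> span {?x, ?y}"
    proof (intro span_minimal subspace_span subsetI)
      fix z assume "z \<in> {u, v}"
      moreover have "u = (1/2) *\<^sub>R ?x + (1/2) *\<^sub>R ?y" "v = (1/2) *\<^sub>R ?x - (1/2) *\<^sub>R ?y"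
        by (simp_all add: scaleR_add_right scaleR_diff_right flip: scaleR_add_left)
      moreover have "(1/2) *\<^sub>R ?x \<in> span {?x, ?y}" "(1/2) *\<^sub>R ?y \<in> span {?x, ?y}"
        by (intro span_scale span_base; simp)+
      ultimately show "z \<in> span {?x, ?y}"
        by (metis insert_iff empty_iff span_add span_diff)
    qed
    finally show ?thesis by blast
  qed
  have "Real_Vector_Spaces.independent {?x, ?y}"
    using spanxy dim \<open>?x \<noteq> ?y\<close> by (intro card_le_dim_spanning[of _ UNIV]) auto
  moreover have "?L = {\<Sum>b\<in>{?x, ?y}. of_int (c b) *\<^sub>R b | c :: 'a \<Rightarrow> int. True}"
  proof (intro equalityI subsetI)
    fix z assume "z \<in> ?L"
    then obtain a b where z: "z = of_int a *\<^sub>R u + of_int b *\<^sub>R v" "even (a - b)" by blast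
    then obtain k where "a - b = 2 * k" by (elim evenE)
    \<comment> \<open>\<open>j\<close> and \<open>k\<close> are the coordinates with respect to the
      basis u + v, u - v.\<close>
    moreover define j where "j = b + k"
    ultimately have ab: "a = j + k" "b = j - k" by simp_all
    have "z = of_int j *\<^sub>R ?x + of_int k *\<^sub>R ?y"
      unfolding z(1) ab by (simp add: algebra_simps)
    then have "z = (\<Sum>w\<in>{?x, ?y}. of_int (if w = ?x then j else k) *\<^sub>R w)"
      using \<open>?x \<noteq> ?y\<close> by simp
    then show "z \<in> {\<Sum>b\<in>{?x, ?y}. of_int (c b) *\<^sub>R b | c :: 'a \<Rightarrow> int. True}"
      by (intro CollectI exI conjI) (assumption, rule TrueI)
  next
    fix z assume "z \<in> {\<Sum>b\<in>{?x, ?y}. of_int (c b) *\<^sub>R b | c :: 'a \<Rightarrow> int. True}"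
    then obtain c :: "'a \<Rightarrow> int" where "z = (\<Sum>b\<in>{?x, ?y}. of_int (c b) *\<^sub>R b)" by blast
    then have "z = of_int (c ?x + c ?y) *\<^sub>R u + of_int (c ?x - c ?y) *\<^sub>R v"
      using \<open>?x \<noteq> ?y\<close> by (simp add: algebra_simps)
    moreover have "even ((c ?x + c ?y) - (c ?x - c ?y))" by simp
    ultimately show "z \<in> ?L" by blast
  qed
  ultimately have full: "full_rank_lattice ?L"
    unfolding full_rank_lattice_def using spanxy by blast
  have xy: "?x \<in> ?L" "?y \<in> ?L"
    by (rule CollectI, rule exI[of _ 1], rule exI[of _ 1], simp)
      (rule CollectI, rule exI[of _ 1], rule exI[of _ "- 1"], simp)
  have nxy: "(norm ?x)\<^sup>2 = (norm u)\<^sup>2 + (norm v)\<^sup>2" "(norm ?y)\<^sup>2 = (norm u)\<^sup>2 + (norm v)\<^sup>2"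
    using norm[of 1 1] norm[of 1 "-1"] by simp_all
  have min: "lattice_minimum ?L = (norm u)\<^sup>2 + (norm v)\<^sup>2"
    unfolding lattice_minimum_def
  proof (rule Least_equality)
    have "?x \<noteq> 0" using nxy(1) pos by auto
    then show "(norm u)\<^sup>2 + (norm v)\<^sup>2 \<in> (\<lambda>x. (norm x)\<^sup>2) ` (?L - {0})"
      using xy(1) nxy(1) by (intro image_eqI[of _ _ ?x]) auto
  next
    fix r assume "r \<in> (\<lambda>x. (norm x)\<^sup>2) ` (?L - {0})"
    then obtain z where z: "z \<in> ?L" "z \<noteq> 0" "r = (norm z)\<^sup>2" by blast
    then obtain a b where ab': "z = of_int a *\<^sub>R u + of_int b *\<^sub>R v" "even (a - b)" by blast
    then have ab: "even (a - b)" "a \<noteq> 0 \<or> b \<noteq> 0" using z(2) by auto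
    have r: "r = of_int (a\<^sup>2) * (norm u)\<^sup>2 + of_int (b\<^sup>2) * (norm v)\<^sup>2"
      using z(3) norm unfolding ab'(1) by simp
    have sq: "of_int (k\<^sup>2) \<ge> (1::real)" if "k \<noteq> 0" for k :: int
      using that zero_less_power2[of k] by linarith
    have sq4: "of_int (k\<^sup>2) \<ge> (4::real)" if k: "k \<noteq> 0" "even k" for k :: int
    proof -
      obtain l where "k = 2 * l" using k(2) by (elim evenE)
      then show ?thesis using sq[of l] k(1) by (simp add: power_mult_distrib)
    qed
    consider "a \<noteq> 0" "b \<noteq> 0" | "a = 0" "b \<noteq> 0" "even b" | "b = 0" "a \<noteq> 0" "even a"
      using ab by auto
    then show "(norm u)\<^sup>2 + (norm v)\<^sup>2 \<le> r"
    proof cases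
      case 1
      have "1 * (norm u)\<^sup>2 + 1 * (norm v)\<^sup>2 \<le> r"
        unfolding r using 1 by (intro add_mono mult_right_mono sq) auto
      then show ?thesis by simp
    next
      case 2
      have "4 * (norm v)\<^sup>2 \<le> of_int (b\<^sup>2) * (norm v)\<^sup>2"
        using 2 by (intro mult_right_mono sq4) auto
      then show ?thesis using r 2 uv by simp
    next
      case 3
      have "4 * (norm u)\<^sup>2 \<le> of_int (a\<^sup>2) * (norm u)\<^sup>2"
        using 3 by (intro mult_right_mono sq4) auto
      then show ?thesis using r 3 vu by simp
    qed
  qed
  have "{?x, ?y} \<subseteq> minimal_vectors ?L"
    unfolding minimal_vectors_def min using xy nxy by blast
  then have "span (minimal_vectors ?L) = UNIV"
    using span_mono spanxy by blast
  with full show ?thesis unfolding well_rounded_def by simp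
qed

section \<open>Well-rounded ideals\<close>

text \<open>Write sqrt D = a + b sqrt E and square: ab = 0, while b = 0 would make sqrt D rational.
  So D = E b^2, and squarefreeness of \<open>E\<close> and then of \<open>D\<close> forces b^2 =
  1.\<close>

lemma sqrt_field_inject:
  assumes "squarefree_radicand D" "squarefree_radicand E" "sqrt_field D = sqrt_field E"
  shows "D = E"
proof -
  interpret D: squarefree_radicand D by fact
  interpret E: squarefree_radicand E by fact
  obtain a b where ab: "D.s = a + b * E.s" "a \<in> \<rat>" "b \<in> \<rat>"
    using D.s_mem assms(3) E.mem_E by metis
  have "a * a + of_int E * b * b + (a * b + b * a) * E.s = of_int D + 0 * E.s"
    using E.mult_mem[OF ab(1) ab(1)] D.s_square by simp
  then have eq: "a * a + of_int E * b * b = of_int D \<and> a * b + b * a = 0"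
    using ab(2,3) by (intro E.eq_imp) auto
  then have "a * b = 0" by (simp add: mult.commute)
  moreover have "b \<noteq> 0" using D.s_irrational ab(1,2) by auto
  ultimately have b: "of_int E * b\<^sup>2 = of_int D" using eq by (simp add: power2_eq_square mult.assoc)
  have "b \<in> \<int>"
    by (rule squarefree_times_square_in_Ints[OF E.squarefree ab(3)]) (simp add: b)
  then obtain z where "b = of_int z" by (elim Ints_cases)
  then have "of_int (E * z\<^sup>2) = (of_int D :: complex)" using b by simp
  then have D: "E * z\<^sup>2 = D" by (simp only: of_int_eq_iff)
  then have "z dvd 1" using D.squarefree by (intro squarefreeD) auto
  then have "z\<^sup>2 = 1" by (auto simp: zdvd1_eq abs_if split: if_splits)
  then show ?thesis using D by simp
qed

lemma in_Reals_of_in_Rats: "a \<in> \<rat> \<Longrightarrow> (a :: complex) \<in> \<real>"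
  by (metis Rats_cases' Reals_divide Reals_of_int)

lemma distinct_set_singleton:
  assumes "distinct xs" "set xs = {a}"
  shows "xs = [a]"
proof -
  have "length xs = 1" using distinct_card[OF assms(1)] assms(2) by simp
  then obtain y where "xs = [y]" by (cases xs) auto
  then show ?thesis using assms(2) by simp
qed

section \<open>The ring of integers and the ideal\<close>

context squarefree_radicand
begin

text \<open>In the coordinates of \<open>algebraic_int_iff\<close>, odd \<open>D\<close> forces m
  and n to have equal parity. That parity makes the coordinates of a product integral and the cross
  term in the norm of a sum divisible by 4.\<close>

lemma ring_of_integers_ring:
  assumes "odd D"
  shows "ring (ring_of_integers K)"
proof -
  interpret field complex_ring by (rule field_from_type_algebra)
  let ?O = "{x \<in> K. algebraic_int x}"
  have mem: "x \<in> ?O \<longleftrightarrow> (\<exists>m n :: int. x = (of_int m + of_int n * s) / 2 \<and> 4 dvd m\<^sup>2 - D * n\<^sup>2)"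
    for x using algebraic_int_iff[of x] by simp
  have "subring ?O complex_ring"
  proof (rule subringI)
    show "\<one>\<^bsub>complex_ring\<^esub> \<in> ?O" using rats_subset by auto
    fix x assume x: "x \<in> ?O"
    then show "\<ominus>\<^bsub>complex_ring\<^esub> x \<in> ?O" using subfield_closed(5)[OF subfield] by auto
    obtain m n where mn: "x = (of_int m + of_int n * s) / 2" "4 dvd m\<^sup>2 - D * n\<^sup>2"
      using x mem by blast
    fix y assume "y \<in> ?O"
    then obtain m' n' where mn': "y = (of_int m' + of_int n' * s) / 2" "4 dvd m'\<^sup>2 - D * n'\<^sup>2"
      using mem by blast
    have "even (m\<^sup>2 - D * n\<^sup>2)" "even (m'\<^sup>2 - D * n'\<^sup>2)"
      by (rule dvd_trans[OF _ mn(2)], simp, rule dvd_trans[OF _ mn'(2)], simp)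
    then have par: "even m \<longleftrightarrow> even n" "even m' \<longleftrightarrow> even n'" using assms by auto
    obtain k k' where k: "m\<^sup>2 - D * n\<^sup>2 = 4 * k" and k': "m'\<^sup>2 - D * n'\<^sup>2 = 4 * k'"
      using mn(2) mn'(2) by (metis dvdE)
    have "even (m * m' + D * n * n')" "even (m * n' + n * m')" "even (m * m' - D * n * n')"
      using par assms by auto
    then obtain M N L where M: "m * m' + D * n * n' = 2 * M" and N: "m * n' + n * m' = 2 * N"
      and L: "m * m' - D * n * n' = 2 * L"
      by (metis evenE)
    \<comment> \<open>Multiplicativity of the norm.\<close>
    have "4 * (M\<^sup>2 - D * N\<^sup>2) = (2 * M)\<^sup>2 - D * (2 * N)\<^sup>2" by (simp add: algebra_simps power_mult_distrib)
    also have "\<dots> = (m\<^sup>2 - D * n\<^sup>2) * (m'\<^sup>2 - D * n'\<^sup>2)"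
      unfolding M[symmetric] N[symmetric] by (simp add: algebra_simps power2_eq_square)
    also have "\<dots> = 4 * (4 * (k * k'))" unfolding k k' by simp
    finally have "M\<^sup>2 - D * N\<^sup>2 = 4 * (k * k')" by (subst (asm) mult_cancel_left) simp
    then have "4 dvd M\<^sup>2 - D * N\<^sup>2" by simp
    moreover have "x * y = (of_int M + of_int N * s) / 2"
    proof -
      have "4 * (x * y) = (of_int m + of_int n * s) * (of_int m' + of_int n' * s)"
        unfolding mn(1) mn'(1) by simp
      also have "\<dots> = of_int (m * m' + D * n * n') + of_int (m * n' + n * m') * s"
        by (subst mult_mem[OF refl refl]) simp
      finally have "2 * (2 * (x * y)) = 2 * (of_int M + of_int N * s)"
        unfolding M N by (simp add: algebra_simps)
      then have "2 * (x * y) = of_int M + of_int N * s" by (subst (asm) mult_cancel_left) simp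
      then show ?thesis by (simp add: eq_divide_eq mult.commute)
    qed
    ultimately have "x * y \<in> ?O" using mem by blast
    then show "x \<otimes>\<^bsub>complex_ring\<^esub> y \<in> ?O" by simp
    have "(m + m')\<^sup>2 - D * (n + n')\<^sup>2
        = (m\<^sup>2 - D * n\<^sup>2) + (m'\<^sup>2 - D * n'\<^sup>2) + 2 * (m * m' - D * n * n')"
      by (simp add: algebra_simps power2_eq_square)
    also have "\<dots> = 4 * (k + k' + L)" unfolding k k' L by simp
    finally have "4 dvd (m + m')\<^sup>2 - D * (n + n')\<^sup>2" by simp
    moreover have "x + y = (of_int (m + m') + of_int (n + n') * s) / 2"
      using mn(1) mn'(1) by (simp add: field_simps)
    ultimately have "x + y \<in> ?O" using mem by blast
    then show "x \<oplus>\<^bsub>complex_ring\<^esub> y \<in> ?O" by simp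
  qed simp
  then show ?thesis unfolding ring_of_integers_def by (rule subring_is_ring)
qed

text \<open>As a group this is generated by p + s and p - s; its embedded image is the centered
  rectangular lattice.\<close>

definition centered_ideal :: "int \<Rightarrow> complex set"
  where "centered_ideal p = {of_int (p * a) + of_int b * s | a b. even (a - b)}"

lemma centered_ideal_not_zero:
  assumes "p \<noteq> 0"
  shows "centered_ideal p \<noteq> {0}"
proof -
  have "of_int (p * 2) + of_int 0 * s \<in> centered_ideal p"
    unfolding centered_ideal_def by (intro CollectI exI conjI) (rule refl, simp)
  moreover have "of_int (p * 2) + of_int 0 * s \<noteq> 0" using assms by simp
  ultimately show ?thesis by blast
qed

text \<open>Because s^2 = pq, multiplication by (m + ns)/2 sends (a, b) to (A, B) with 2A = ma + nqb
  and 2B = mb + npa. The point is that A - B is even, which is the divisibility by 4 in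
  \<open>dvd4\<close>.\<close>

lemma ideal_centered_ideal:
  assumes D: "D = p * q" and "odd p" "odd q"
  shows "ideal (centered_ideal p) (ring_of_integers K)"
proof (rule idealI)
  have oddD: "odd D" using assms by simp
  show ring: "ring (ring_of_integers K)" by (rule ring_of_integers_ring[OF oddD])
  interpret O: ring "ring_of_integers K" by fact
  interpret C: field complex_ring by (rule field_from_type_algebra)
  have sub: "centered_ideal p \<subseteq> {x \<in> K. algebraic_int x}"
  proof
    fix x assume "x \<in> centered_ideal p"
    then obtain a b where "x = of_int (p * a) + of_int b * s" unfolding centered_ideal_def by blast
    then have "x = (of_int (2 * (p * a)) + of_int (2 * b) * s) / 2"
      by (simp add: field_simps)
    moreover have "4 dvd (2 * (p * a))\<^sup>2 - D * (2 * b)\<^sup>2" by (simp add: power_mult_distrib)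
    ultimately show "x \<in> {x \<in> K. algebraic_int x}" using algebraic_int_iff[of x] by blast
  qed
  have neg: "- x \<in> centered_ideal p" if x: "x \<in> centered_ideal p" for x
  proof -
    obtain a b where "x = of_int (p * a) + of_int b * s" "even (a - b)"
      using x unfolding centered_ideal_def by blast
    then have "- x = of_int (p * (- a)) + of_int (- b) * s" "even ((- a) - (- b))" by auto
    then show ?thesis unfolding centered_ideal_def by blast
  qed
  show "subgroup (centered_ideal p) (add_monoid (ring_of_integers K))"
  proof (rule O.add.subgroupI)
    show "centered_ideal p \<subseteq> carrier (ring_of_integers K)"
      using sub by (simp add: ring_of_integers_def)
    have "of_int (p * 2) + of_int 0 * s \<in> centered_ideal p"
      unfolding centered_ideal_def by (intro CollectI exI conjI) (rule refl, simp)
    then show "centered_ideal p \<noteq> {}" by blast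
  next
    fix x assume x: "x \<in> centered_ideal p"
    have "\<ominus>\<^bsub>ring_of_integers K\<^esub> x = - x"
      using sub x neg[OF x] by (intro O.minus_equality) (auto simp: ring_of_integers_def)
    then show "\<ominus>\<^bsub>ring_of_integers K\<^esub> x \<in> centered_ideal p" using neg[OF x] by simp
  next
    fix x y assume "x \<in> centered_ideal p" "y \<in> centered_ideal p"
    then obtain a b c d where "x = of_int (p * a) + of_int b * s" "even (a - b)"
      "y = of_int (p * c) + of_int d * s" "even (c - d)"
      unfolding centered_ideal_def by blast
    then have "x + y = of_int (p * (a + c)) + of_int (b + d) * s" "even ((a + c) - (b + d))"
      by (auto simp: algebra_simps)
    then have "x + y \<in> centered_ideal p" unfolding centered_ideal_def by blast
    then show "x \<oplus>\<^bsub>ring_of_integers K\<^esub> y \<in> centered_ideal p"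
      by (simp add: ring_of_integers_def)
  qed
  have mult: "x * y \<in> centered_ideal p"
    if y: "y \<in> centered_ideal p" and x: "x \<in> carrier (ring_of_integers K)" for x y
  proof -
    obtain m n where mn: "x = (of_int m + of_int n * s) / 2" "4 dvd m\<^sup>2 - D * n\<^sup>2"
      using x algebraic_int_iff[of x] by (auto simp: ring_of_integers_def)
    obtain a b where ab: "y = of_int (p * a) + of_int b * s" "even (a - b)"
      using y unfolding centered_ideal_def by blast
    have "even (m\<^sup>2 - D * n\<^sup>2)" by (rule dvd_trans[OF _ mn(2)]) simp
    then have par: "even m \<longleftrightarrow> even n" using oddD by auto
    have dvd4: "4 dvd m * (a - b) + n * (q * b - p * a)"
    proof (cases "even m")
      case True
      then obtain m' n' where "m = 2 * m'" "n = 2 * n'" using par by (auto elim!: evenE)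
      moreover have "even (m' * (a - b) + n' * (q * b - p * a))" using ab(2) assms by auto
      then obtain r where "m' * (a - b) + n' * (q * b - p * a) = 2 * r" by (elim evenE)
      ultimately have "m * (a - b) + n * (q * b - p * a) = 4 * r" by (simp add: algebra_simps)
      then show ?thesis by simp
    next
      case False
      \<comment> \<open>For odd m and n the integrality condition forces D = pq to be 1 modulo 4,
        hence p and q agree modulo 4.\<close>
      then obtain i j where "m = 2 * i + 1" "n = 2 * j + 1" using par by (meson oddE)
      moreover obtain k l where p: "p = 2 * k + 1" and q: "q = 2 * l + 1" using assms by (meson oddE)
      ultimately have "m\<^sup>2 - D * n\<^sup>2 = 4 * (i\<^sup>2 + i - D * (j\<^sup>2 + j) - k * l) - 2 * (k + l)"
        using D by (simp add: power2_eq_square algebra_simps)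
      then have "2 * 2 dvd 2 * (k + l)"
        using mn(2) by (metis dvd_diff_right_iff dvd_triv_left mult_2 numeral_Bit0 one_add_one mult_numeral_1_right)
      then have "even (k - l)" by (subst (asm) dvd_mult_cancel_left) simp
      then obtain r where "k - l = 2 * r" by (elim evenE)
      then have "p - q = 4 * r" unfolding p q by simp
      then have "4 dvd p - q" by simp
      then obtain k where k: "q = p - 4 * k" by (auto elim!: dvdE simp: algebra_simps)
      \<comment> \<open>Replacing q by p modulo 4 leaves a product of two even factors.\<close>
      have "m * (a - b) + n * (q * b - p * a) = (a - b) * (m - n * p) + 4 * (- n * k * b)"
        unfolding k by (simp add: algebra_simps)
      moreover have "2 * 2 dvd (a - b) * (m - n * p)"
        using False par ab(2) assms(2) by (intro mult_dvd_mono) auto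
      ultimately show ?thesis by simp
    qed
    have "even (m * a + n * q * b)" "even (m * b + n * p * a)"
      using par ab(2) assms by auto
    then obtain A B where A: "m * a + n * q * b = 2 * A" and B: "m * b + n * p * a = 2 * B"
      by (metis evenE)
    have "m * (a - b) + n * (q * b - p * a) = 2 * (A - B)"
      unfolding right_diff_distrib A[symmetric] B[symmetric] by (simp add: algebra_simps)
    then have "2 * 2 dvd 2 * (A - B)" using dvd4 by simp
    then have "even (A - B)" by (subst (asm) dvd_mult_cancel_left) simp
    moreover have "x * y = of_int (p * A) + of_int B * s"
    proof -
      have "2 * (x * y) = (of_int m + of_int n * s) * (of_int (p * a) + of_int b * s)"
        unfolding mn(1) ab(1) by simp
      also have "\<dots> = of_int (p * (m * a + n * q * b)) + of_int (m * b + n * p * a) * s"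
        by (subst mult_mem[OF refl refl]) (simp add: D algebra_simps)
      finally have "2 * (x * y) = 2 * (of_int (p * A) + of_int B * s)"
        unfolding A B by (simp add: algebra_simps)
      then show ?thesis by (subst (asm) mult_cancel_left) simp
    qed
    ultimately show ?thesis unfolding centered_ideal_def by blast
  qed
  fix x y assume "y \<in> centered_ideal p" "x \<in> carrier (ring_of_integers K)"
  then have "x * y \<in> centered_ideal p" by (rule mult)
  then show "x \<otimes>\<^bsub>ring_of_integers K\<^esub> y \<in> centered_ideal p"
    "y \<otimes>\<^bsub>ring_of_integers K\<^esub> x \<in> centered_ideal p"
    by (simp_all add: ring_of_integers_def mult.commute)
qed

text \<open>Common reduction for both signs of \<open>D\<close>. The scale \<open>c\<close> is 2 in
  the real case, where both coordinates carry each value, and 1 in the imaginary case.\<close>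

lemma well_rounded_if_linear:
  fixes u v :: "real ^ 2"
  assumes lin: "\<And>a b :: int. canonical_embedding rs cs (of_int (p * a) + of_int b * s)
      = of_int a *\<^sub>R u + of_int b *\<^sub>R v"
    and orth: "u \<bullet> v = 0" and c: "c > 0"
    and u: "(norm u)\<^sup>2 = c * of_int (p\<^sup>2)" and v: "(norm v)\<^sup>2 = c * of_int \<bar>D\<bar>"
    and D: "D = p * q" "p > 0" "p \<le> 3 * \<bar>q\<bar>" "\<bar>q\<bar> \<le> 3 * p"
  shows "well_rounded (ideal_lattice rs cs (centered_ideal p) :: (real ^ 2) set)"
proof -
  have "(ideal_lattice rs cs (centered_ideal p) :: (real ^ 2) set)
      = {of_int a *\<^sub>R u + of_int b *\<^sub>R v | a b. even (a - b)}"
    unfolding ideal_lattice_def centered_ideal_def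
  proof (intro equalityI subsetI)
    fix z :: "real ^ 2"
    assume "z \<in> canonical_embedding rs cs ` {of_int (p * a) + of_int b * s | a b. even (a - b)}"
    then show "z \<in> {of_int a *\<^sub>R u + of_int b *\<^sub>R v | a b. even (a - b)}" using lin by blast
  next
    fix z
    assume "z \<in> {of_int a *\<^sub>R u + of_int b *\<^sub>R v | a b. even (a - b)}"
    then obtain a b where "z = of_int a *\<^sub>R u + of_int b *\<^sub>R v" "even (a - b)" by blast
    then show "z \<in> canonical_embedding rs cs ` {of_int (p * a) + of_int b * s | a b. even (a - b)}"
      using lin[of a b] by (intro image_eqI[of _ _ "of_int (p * a) + of_int b * s"]) auto
  qed
  moreover have "well_rounded {of_int a *\<^sub>R u + of_int b *\<^sub>R v | a b. even (a - b)}"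
  proof (rule well_rounded_centered_rectangular)
    have absD: "\<bar>D\<bar> = p * \<bar>q\<bar>" using D(1,2) by (simp add: abs_mult)
    \<comment> \<open>Multiplying the bounds between \<open>p\<close> and |q| by \<open>p\<close>
      turns them into bounds between p^2 and |D|.\<close>
    have "p * p \<le> p * (3 * \<bar>q\<bar>)" "p * \<bar>q\<bar> \<le> p * (3 * p)"
      using D by (auto intro!: mult_left_mono)
    then have le: "p\<^sup>2 \<le> 3 * \<bar>D\<bar>" "\<bar>D\<bar> \<le> 3 * p\<^sup>2"
      unfolding absD power2_eq_square by simp_all
    have "(norm u)\<^sup>2 \<le> c * of_int (3 * \<bar>D\<bar>)" "(norm v)\<^sup>2 \<le> c * of_int (3 * p\<^sup>2)"
      unfolding u v using c le by (auto intro!: mult_left_mono simp del: of_int_mult of_int_power of_int_abs)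
    then show "(norm u)\<^sup>2 \<le> 3 * (norm v)\<^sup>2" "(norm v)\<^sup>2 \<le> 3 * (norm u)\<^sup>2"
      unfolding u v by simp_all
    show "u \<noteq> 0" "v \<noteq> 0" using u v c D(2) nonzero by auto
  qed (use orth in simp_all)
  ultimately show ?thesis by simp
qed

section \<open>The lattice of the ideal for positive and for negative \<open>D\<close>\<close>

lemma embeddings_int:
  "restrict id K (of_int a + of_int b * s) = of_int a + of_int b * s"
  "restrict conj K (of_int a + of_int b * s) = of_int a - of_int b * s"
proof -
  have "of_int a + of_int b * s \<in> K" by (rule mem_I) simp_all
  moreover have "conj (of_int a + of_int b * s) = of_int a - of_int b * s" by (rule conj_eq) simp_all
  ultimately show "restrict id K (of_int a + of_int b * s) = of_int a + of_int b * s"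
    "restrict conj K (of_int a + of_int b * s) = of_int a - of_int b * s"
    by (simp_all only: restrict_apply' id_apply)
qed

lemma embeddings_s: "restrict id K s = s" "restrict conj K s = - s"
  using s_mem conj_s by (simp_all only: restrict_apply' id_apply)

lemma real_embeddings_pos:
  assumes "D > 0"
  shows "real_embeddings K = {restrict id K, restrict conj K}" "complex_embeddings K = {}"
proof -
  have "s \<in> \<real>" using assms by (simp add: csqrt_of_real_nonneg)
  have "h x \<in> \<real>" if h: "h \<in> embeddings K" and x: "x \<in> K" for h x
  proof -
    obtain a b where ab: "x = a + b * s" "a \<in> \<rat>" "b \<in> \<rat>" using x by (rule mem_E)
    have "h s \<in> \<real>" using h \<open>s \<in> \<real>\<close> embeddings_s unfolding embeddings_eq by auto
    then show ?thesis
      unfolding ab(1) embeddings_apply[OF h ab(2,3)] using ab(2,3) in_Reals_of_in_Rats by simp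
  qed
  then show "real_embeddings K = {restrict id K, restrict conj K}"
    unfolding real_embeddings_def embeddings_eq[symmetric] by blast
  then show "complex_embeddings K = {}" unfolding complex_embeddings_def embeddings_eq by simp
qed

text \<open>\<open>s\<close> is purely imaginary, so complex conjugation agrees with
  \<open>conj\<close> on \<open>K\<close> and the two embeddings form one conjugate pair.\<close>

lemma complex_embeddings_neg:
  assumes "D < 0"
  shows "real_embeddings K = {}" "complex_embeddings K = {restrict id K, restrict conj K}"
    "conj_embedding K (restrict id K) = restrict conj K"
proof -
  have s: "s = \<i> * of_real (sqrt (- of_int D))" using assms by (simp add: csqrt_of_real_nonpos)
  then have "s \<notin> \<real>" using assms by (auto simp: complex_is_Real_iff)
  then have "\<not> h ` K \<subseteq> \<real>" if "h \<in> {restrict id K, restrict conj K}" for h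
    using that embeddings_s s_mem by (metis Reals_minus_iff image_subset_iff insertE singletonD)
  then show real: "real_embeddings K = {}"
    unfolding real_embeddings_def embeddings_eq by blast
  then show "complex_embeddings K = {restrict id K, restrict conj K}"
    unfolding complex_embeddings_def embeddings_eq by simp
  have "cnj (a + b * s) = a - b * s" if "a \<in> \<rat>" "b \<in> \<rat>" for a b
    using that[THEN in_Reals_of_in_Rats] s by (simp add: Reals_cnj_iff)
  then have "cnj x = conj x" if "x \<in> K" for x
    using that by (metis conj_eq mem_E)
  then show "conj_embedding K (restrict id K) = restrict conj K"
    by (auto simp: conj_embedding_def fun_eq_iff)
qed

text \<open>Reordering the two real embeddings only flips the sign of the vector attached to
  \<open>s\<close>; the sign \<open>e\<close> records the order.\<close>

lemma well_rounded_real: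
  assumes sys: "embedding_system K rs cs" and "D > 0"
    and D: "D = p * q" "p > 0" "p \<le> 3 * \<bar>q\<bar>" "\<bar>q\<bar> \<le> 3 * p"
  shows "well_rounded (ideal_lattice rs cs (centered_ideal p) :: (real ^ 2) set)"
proof -
  have s: "s = of_real (sqrt (of_int D))" using \<open>D > 0\<close> by (simp add: csqrt_of_real_nonneg)
  have apply_int:
    "Re (restrict id K (of_int (p * a) + of_int b * s)) = of_int p * of_int a + of_int b * sqrt (of_int D)"
    "Re (restrict conj K (of_int (p * a) + of_int b * s)) = of_int p * of_int a - of_int b * sqrt (of_int D)"
    for a b unfolding embeddings_int by (simp_all add: s)
  have cs: "cs = []" and rs: "distinct rs" "set rs = {restrict id K, restrict conj K}"
    using sys real_embeddings_pos[OF \<open>D > 0\<close>] by (auto simp: embedding_system_def)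
  have "length rs = 2"
    using rs embeddings_distinct by (metis distinct_card card_2_iff)
  then obtain g h where gh: "rs = [g, h]"
    by (auto simp: numeral_2_eq_2 length_Suc_conv)
  have "rs = [restrict id K, restrict conj K] \<or> rs = [restrict conj K, restrict id K]"
    using rs unfolding gh by (auto simp: doubleton_eq_iff)
  then obtain e :: real where e: "e\<^sup>2 = 1" and
    lin: "\<And>a b :: int. (canonical_embedding rs cs (of_int (p * a) + of_int b * s) :: real ^ 2)
      = of_int a *\<^sub>R vector [of_int p, of_int p] + of_int b *\<^sub>R vector [e * sqrt (of_int D), - e * sqrt (of_int D)]"
  proof (elim disjE)
    assume r: "rs = [restrict id K, restrict conj K]"
    show ?thesis
      by (rule that[of 1]) (simp_all add: r cs canonical_embedding_def apply_int vec_eq_iff forall_2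
          del: of_int_mult restrict_apply)
  next
    assume r: "rs = [restrict conj K, restrict id K]"
    show ?thesis
      by (rule that[of "-1"]) (simp_all add: r cs canonical_embedding_def apply_int vec_eq_iff forall_2
          del: of_int_mult restrict_apply)
  qed
  show ?thesis
  proof (rule well_rounded_if_linear[OF lin _ _ _ _ D, where c = 2])
    show "(norm (vector [of_int p, of_int p] :: real ^ 2))\<^sup>2 = 2 * of_int (p\<^sup>2)"
      unfolding power2_norm_eq_inner by (simp add: inner_vec_def sum_2 power2_eq_square)
    have "e * sqrt (of_int D) * (e * sqrt (of_int D)) = e\<^sup>2 * (sqrt (of_int D))\<^sup>2"
      by (simp only: power2_eq_square mult_ac)
    then show "(norm (vector [e * sqrt (of_int D), - e * sqrt (of_int D)] :: real ^ 2))\<^sup>2 = 2 * of_int \<bar>D\<bar>"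
      using \<open>D > 0\<close> e unfolding power2_norm_eq_inner by (simp add: inner_vec_def sum_2)
  qed (simp_all add: inner_vec_def sum_2)
qed

text \<open>Here \<open>e\<close> records which member of the conjugate pair was chosen; the choice
  only flips the imaginary coordinate.\<close>

lemma well_rounded_imaginary:
  assumes sys: "embedding_system K rs cs" and "D < 0"
    and D: "D = p * q" "p > 0" "p \<le> 3 * \<bar>q\<bar>" "\<bar>q\<bar> \<le> 3 * p"
  shows "well_rounded (ideal_lattice rs cs (centered_ideal p) :: (real ^ 2) set)"
proof -
  note emb = complex_embeddings_neg[OF \<open>D < 0\<close>]
  have s: "s = \<i> * of_real (sqrt (- of_int D))" using \<open>D < 0\<close> by (simp add: csqrt_of_real_nonpos)
  have apply_int:
    "Re (restrict id K (of_int (p * a) + of_int b * s)) = of_int p * of_int a"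
    "Im (restrict id K (of_int (p * a) + of_int b * s)) = of_int b * sqrt (- of_int D)"
    "Re (restrict conj K (of_int (p * a) + of_int b * s)) = of_int p * of_int a"
    "Im (restrict conj K (of_int (p * a) + of_int b * s)) = - of_int b * sqrt (- of_int D)"
    for a b unfolding embeddings_int by (simp_all add: s)
  have rs: "rs = []" and cs: "distinct cs" "set cs \<subseteq> {restrict id K, restrict conj K}"
    "restrict id K \<in> set cs \<longleftrightarrow> restrict conj K \<notin> set cs"
    using sys emb by (auto simp: embedding_system_def)
  then have set_cs: "set cs = {restrict id K} \<or> set cs = {restrict conj K}" by blast
  have "cs = [restrict id K] \<or> cs = [restrict conj K]"
    using set_cs distinct_set_singleton[OF cs(1)] by blast
  then obtain e :: real where e: "e\<^sup>2 = 1" and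
    lin: "\<And>a b :: int. (canonical_embedding rs cs (of_int (p * a) + of_int b * s) :: real ^ 2)
      = of_int a *\<^sub>R vector [of_int p, 0] + of_int b *\<^sub>R vector [0, e * sqrt (- of_int D)]"
  proof (elim disjE)
    assume r: "cs = [restrict id K]"
    show ?thesis
      by (rule that[of 1]) (simp_all add: r rs canonical_embedding_def apply_int vec_eq_iff forall_2
          del: of_int_mult restrict_apply)
  next
    assume r: "cs = [restrict conj K]"
    show ?thesis
      by (rule that[of "-1"]) (simp_all add: r rs canonical_embedding_def apply_int vec_eq_iff forall_2
          del: of_int_mult restrict_apply)
  qed
  show ?thesis
  proof (rule well_rounded_if_linear[OF lin _ _ _ _ D, where c = 1])
    show "(norm (vector [of_int p, 0] :: real ^ 2))\<^sup>2 = 1 * of_int (p\<^sup>2)"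
      unfolding power2_norm_eq_inner by (simp add: inner_vec_def sum_2 power2_eq_square)
    have "e * sqrt (- of_int D) * (e * sqrt (- of_int D)) = e\<^sup>2 * (sqrt (- of_int D))\<^sup>2"
      by (simp only: power2_eq_square mult_ac)
    then show "(norm (vector [0, e * sqrt (- of_int D)] :: real ^ 2))\<^sup>2 = 1 * of_int \<bar>D\<bar>"
      using \<open>D < 0\<close> e unfolding power2_norm_eq_inner by (simp add: inner_vec_def sum_2)
  qed (simp_all add: inner_vec_def sum_2)
qed

end

section \<open>Infinitely many fields of each signature\<close>

theorem theorem1p1:
  shows "infinite {K. real_quadratic_field K \<and>
           (\<exists>I. ideal I (ring_of_integers K) \<and> I \<noteq> {0} \<and>
              (\<forall>rs cs. embedding_system K rs cs \<longrightarrow>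
                 well_rounded (ideal_lattice rs cs I :: (real ^ 2) set)))} \<and>
         infinite {K. imaginary_quadratic_field K \<and>
           (\<exists>I. ideal I (ring_of_integers K) \<and> I \<noteq> {0} \<and>
              (\<forall>rs cs. embedding_system K rs cs \<longrightarrow>
                 well_rounded (ideal_lattice rs cs I :: (real ^ 2) set)))}"
    (is "infinite ?R \<and> infinite ?C")
proof -
  let ?S = "{D::int. squarefree D \<and> (\<exists>p q. D = p * q \<and> odd p \<and> odd q \<and> 0 < p \<and> p < q \<and> q < 3 * p)}"
  \<comment> \<open>This keeps \<open>D\<close> away from 1 and makes \<open>- D\<close> negative,
    so both are admissible radicands.\<close>
  have pos: "D > 1" if DS: "D \<in> ?S" for D
  proof -
    obtain p q where "D = p * q" "0 < p" "p < q" using DS by blast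
    moreover from this have "p * q \<ge> 1 * q" by (intro mult_right_mono) auto
    ultimately show ?thesis by linarith
  qed
  have sqf: "squarefree_radicand D" "squarefree_radicand (- D)" if "D \<in> ?S" for D
  proof -
    have "squarefree D" using that by blast
    then show "squarefree_radicand D" "squarefree_radicand (- D)"
      using pos[OF that] unfolding squarefree_radicand_def by simp_all
  qed
  \<comment> \<open>Injectivity turns infinitely many radicands into infinitely many fields.\<close>
  have "inj_on sqrt_field ?S"
    by (rule inj_onI) (rule sqrt_field_inject[OF sqf(1) sqf(1)])
  moreover have "inj_on (\<lambda>D. sqrt_field (- D)) ?S"
  proof (rule inj_onI)
    fix D E assume "D \<in> ?S" "E \<in> ?S" "sqrt_field (- D) = sqrt_field (- E)"
    then have "- D = - E" by (intro sqrt_field_inject sqf(2))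
    then show "D = E" by simp
  qed
  ultimately have inf: "infinite (sqrt_field ` ?S)" "infinite ((\<lambda>D. sqrt_field (- D)) ` ?S)"
    using infinite_squarefree_balanced_products by (simp_all only: finite_image_iff not_False_eq_True)
  have "sqrt_field ` ?S \<subseteq> ?R"
  proof
    fix K assume "K \<in> sqrt_field ` ?S"
    then obtain D where K: "K = sqrt_field D" and DS: "D \<in> ?S" by blast
    then obtain p q where pq: "D = p * q" "odd p" "odd q" "0 < p" "p < q" "q < 3 * p" by blast
    interpret squarefree_radicand D by (rule sqf[OF DS])
    have "D > 0" using pos[OF DS] by simp
    have "real_quadratic_field (sqrt_field D)"
      using quadratic_field real_embeddings_pos[OF \<open>D > 0\<close>] by (simp add: real_quadratic_field_def)
    moreover have "ideal (centered_ideal p) (ring_of_integers (sqrt_field D))"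
      using pq by (intro ideal_centered_ideal)
    moreover have "centered_ideal p \<noteq> {0}" using pq by (intro centered_ideal_not_zero) simp
    moreover have "well_rounded (ideal_lattice rs cs (centered_ideal p) :: (real ^ 2) set)"
      if "embedding_system (sqrt_field D) rs cs" for rs cs
      using that \<open>D > 0\<close> pq by (intro well_rounded_real[of _ _ p q]) auto
    ultimately show "K \<in> ?R" unfolding K by blast
  qed
  moreover have "(\<lambda>D. sqrt_field (- D)) ` ?S \<subseteq> ?C"
  proof
    fix K assume "K \<in> (\<lambda>D. sqrt_field (- D)) ` ?S"
    then obtain D where K: "K = sqrt_field (- D)" and DS: "D \<in> ?S" by blast
    then obtain p q where pq: "D = p * q" "odd p" "odd q" "0 < p" "p < q" "q < 3 * p" by blast
    interpret squarefree_radicand "- D" by (rule sqf[OF DS])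
    have neg: "- D < 0" using pos[OF DS] by simp
    have "imaginary_quadratic_field (sqrt_field (- D))"
      using quadratic_field complex_embeddings_neg[OF neg] by (simp add: imaginary_quadratic_field_def)
    \<comment> \<open>The negative radicand factors as \<open>p\<close> times \<open>- q\<close>, so
      the same \<open>p\<close> serves.\<close>
    moreover have "ideal (centered_ideal p) (ring_of_integers (sqrt_field (- D)))"
      using pq by (intro ideal_centered_ideal[of p "- q"]) auto
    moreover have "centered_ideal p \<noteq> {0}" using pq by (intro centered_ideal_not_zero) simp
    moreover have "well_rounded (ideal_lattice rs cs (centered_ideal p) :: (real ^ 2) set)"
      if "embedding_system (sqrt_field (- D)) rs cs" for rs cs
      using that neg pq by (intro well_rounded_imaginary[of _ _ p "- q"]) auto
    ultimately show "K \<in> ?C" unfolding K by blast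
  qed
  ultimately show ?thesis using inf[THEN infinite_super[rotated]] by (intro conjI)
qed

end
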